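(* Let $\lambda,n,h$ be positive integers and let $a_1,\dots,a_k$ be positive integers with $\sum_{j\in[k]}a_j=\lambda\binom{n}{h}$. Then the complete $\lambda$-fold $n$-vertex $h$-uniform hypergraph $\lambda K_n^h$ can be decomposed into almost regular spanning sub-hypergraphs $\mathcal F(1),\dots,\mathcal F(k)$ such that for all $j\in[k]$: (i) $\mathcal F(j)$ has $a_j$ edges; (ii) $\deg_{\mathcal F(j)}(v)\approx ha_j/n$ for each vertex $v$; (iii) $\mathcal F(j)$ is connected if and only if $(h-1)a_j\geq n-1$ (i.e., $a_j\ge (n-1)/(h-1)$ when $h\ge 2$).
   Context: $\lambda K_n^h$ is the hypergraph on $n$ vertices in which every $h$-element subset of the vertices is an edge with multiplicity $\lambda$, and there are no other edges. A decomposition into spanning sub-hypergraphs is a partition of the edge multiset into parts, each taken with the full vertex set. Degree of a vertex is the number of edges (with multiplicity) containing it. A hypergraph is almost regular if there is an integer $d$ such that every vertex has degree $d$ or $d+1$. For reals, $x\approx y$ means $\lfloor y\rfloor\le x\le\lceil y\rceil$. *)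

theory Defs
  imports Complex_Main "HOL-Library.Multiset"
begin

record 'a hypergraph =
  verts :: "'a set"
  edges :: "'a set multiset"

definition complete_hypergraph :: "nat \<Rightarrow> 'a set \<Rightarrow> nat \<Rightarrow> 'a hypergraph" where
  "complete_hypergraph lam V h =
     \<lparr>verts = V, edges = repeat_mset lam (mset_set {e. e \<subseteq> V \<and> card e = h})\<rparr>"

definition hdegree :: "'a hypergraph \<Rightarrow> 'a \<Rightarrow> nat" where
  "hdegree G v = size {#e \<in># edges G. v \<in> e#}"

definition almost_regular :: "'a hypergraph \<Rightarrow> bool" where
  "almost_regular G \<longleftrightarrow>
     (\<exists>d::int. \<forall>v\<in>verts G. int (hdegree G v) = d \<or> int (hdegree G v) = d + 1)"

definition hadjacent :: "'a hypergraph \<Rightarrow> 'a \<Rightarrow> 'a \<Rightarrow> bool" where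
  "hadjacent G u v \<longleftrightarrow> (\<exists>e. e \<in># edges G \<and> u \<in> e \<and> v \<in> e)"

text \<open>Any two vertices are joined by a walk of consecutively adjacent vertices. All members of
  \<open>verts G\<close> count, so an isolated vertex disconnects a hypergraph with at least two vertices.\<close>

definition hconnected :: "'a hypergraph \<Rightarrow> bool" where
  "hconnected G \<longleftrightarrow> (\<forall>u\<in>verts G. \<forall>v\<in>verts G. (hadjacent G)\<^sup>*\<^sup>* u v)"

definition spanning_subhypergraph :: "'a hypergraph \<Rightarrow> 'a hypergraph \<Rightarrow> bool" where
  "spanning_subhypergraph H G \<longleftrightarrow> verts H = verts G \<and> edges H \<subseteq># edges G"

text \<open>Parallel edges are not distinguished, so a partition of the edge multiset is a family of
  multisets that sums to it.\<close>

definition spanning_decomposition ::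
  "'a hypergraph \<Rightarrow> 'i set \<Rightarrow> ('i \<Rightarrow> 'a hypergraph) \<Rightarrow> bool" where
  "spanning_decomposition G I F \<longleftrightarrow>
     (\<forall>j\<in>I. spanning_subhypergraph (F j) G) \<and> (\<Sum>j\<in>I. edges (F j)) = edges G"

definition approx :: "real \<Rightarrow> real \<Rightarrow> bool" where
  "approx x y \<longleftrightarrow> of_int \<lfloor>y\<rfloor> \<le> x \<and> x \<le> of_int \<lceil>y\<rceil>"

end

theory Submission
  imports Defs "HOL-Library.Disjoint_Sets"
begin

text \<open>Start with all \<open>n\<close> vertices amalgamated into one and split them off one at a time, as in Baranyai's
  theorem. At each step the \<open>a j\<close> hyperedges of class \<open>j\<close> are recorded by their traces on the vertices
  split off so far, and across all classes trace \<open>S\<close> occurs \<open>lam * (f choose (h - card S))\<close> times, where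
  \<open>f\<close> vertices remain amalgamated. The next vertex receives a \<open>1/f\<close> share of the hinges at the amalgamated
  vertex, rounded to integers by integrality of flows so that the shares are fair simultaneously on
  each trace summed over all classes and, within each class, on a laminar family of hinge sets: the
  single traces, the components left after deleting the amalgamated vertex, the union of the components
  with at least two hinges, and all hinges. The last three keep degrees balanced and, if
  \<open>n - 1 \<le> (h - 1) * a j\<close>, preserve the inequality that allows class \<open>j\<close> to end up connected.\<close>

section \<open>Integral rounding of circulations\<close>

text \<open>The classes compete for the same traces, while inside a class several hinge sets must be
  balanced at once. Two partition structures, each laminar, can be rounded by one circulation; this
  is why all conditions on a class are arranged as successively coarser partitions of its traces.
  Across classes no rounding error is tolerable, and none occurs: with \<open>m = h - card S\<close>
  at least 1, trace \<open>S\<close> carries \<open>lam * m * (f choose m)\<close> hinges in all, a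
  multiple of \<open>f\<close> because
  \<open>m * (f choose m) = f * ((f - 1) choose (m - 1))\<close>. Its share is therefore exact, and
  Pascal's rule gives the counts of the traces that stay unchanged. The threshold
  \<open>n - 1 \<le> (h - 1) * a j\<close> is the connectivity inequality of the initial state,
  where every hyperedge is a component by itself. Balancing components one by one would not preserve
  it together with the hinge condition: the new vertex could meet only components with a single
  hinge each and close them off while others remain. The group of components with at least two
  hinges is balanced to exclude this.\<close>

lemma homogeneous_system_nontrivial:
  fixes c :: "'v \<Rightarrow> 'e \<Rightarrow> real"
  assumes "finite M" and "finite F" and "card M < card F"
  shows "\<exists>w. (\<exists>e\<in>F. w e \<noteq> 0) \<and> (\<forall>v\<in>M. (\<Sum>e\<in>F. c v e * w e) = 0)"
  using assms
proof (induction M arbitrary: F c rule: finite_induct)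
  case empty
  then have "F \<noteq> {}" by auto
  then show ?case by (intro exI[of _ "\<lambda>_. 1"]) auto
next
  case (insert m M)
  show ?case
  proof (cases "\<forall>e\<in>F. c m e = 0")
    case True
    have "card M < card F" using insert by simp
    from insert.IH[OF insert.prems(1) this, of c] obtain w where
      "\<exists>e\<in>F. w e \<noteq> 0" "\<forall>v\<in>M. (\<Sum>e\<in>F. c v e * w e) = 0" by blast
    then show ?thesis using True by (intro exI[of _ w]) simp
  next
    case False
    then obtain e0 where e0: "e0 \<in> F" "c m e0 \<noteq> 0" by blast
    define F' where "F' = F - {e0}"
    \<comment> \<open>Gaussian elimination with pivot \<open>c m e0\<close>: the reduced equations
      no longer contain \<open>e0\<close>, and equation \<open>m\<close> later determines the value
      at \<open>e0\<close>.\<close>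
    define c' where "c' v e = c v e - c v e0 / c m e0 * c m e" for v e
    have F': "finite F'" "card M < card F'" "e0 \<notin> F'" "F = insert e0 F'"
      using insert e0 by (auto simp: F'_def)
    from insert.IH[OF F'(1,2), of c'] obtain w where
      w: "\<exists>e\<in>F'. w e \<noteq> 0" "\<And>v. v \<in> M \<Longrightarrow> (\<Sum>e\<in>F'. c' v e * w e) = 0" by blast
    define s where "s = (\<Sum>e\<in>F'. c m e * w e)"
    define w' where "w' = w(e0 := - s / c m e0)"
    have split: "(\<Sum>e\<in>F. c v e * w' e) = (\<Sum>e\<in>F'. c v e * w e) - c v e0 / c m e0 * s" for v
    proof -
      have "(\<Sum>e\<in>F'. c v e * w' e) = (\<Sum>e\<in>F'. c v e * w e)"
        using F'(3) by (intro sum.cong) (auto simp: w'_def)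
      then show ?thesis using F' by (simp add: w'_def)
    qed
    have "(\<Sum>e\<in>F. c v e * w' e) = 0" if "v \<in> M" for v
    proof -
      have "0 = (\<Sum>e\<in>F'. c v e * w e - c v e0 / c m e0 * (c m e * w e))"
        using w(2)[OF that] by (simp add: c'_def algebra_simps)
      also have "\<dots> = (\<Sum>e\<in>F'. c v e * w e) - c v e0 / c m e0 * s"
        by (simp add: sum_subtractf sum_distrib_left s_def)
      finally show ?thesis using split by simp
    qed
    moreover have "(\<Sum>e\<in>F. c m e * w' e) = 0" using split[of m] e0 by (simp add: s_def)
    moreover have "\<exists>e\<in>F. w' e \<noteq> 0" using w(1) F' by (auto simp: w'_def)
    ultimately show ?thesis by (intro exI[of _ w']) auto
  qed
qed

definition circulation :: "'e set \<Rightarrow> ('e \<Rightarrow> 'v) \<Rightarrow> ('e \<Rightarrow> 'v) \<Rightarrow> ('e \<Rightarrow> real) \<Rightarrow> bool" where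
  "circulation A src tgt g \<longleftrightarrow> (\<forall>v. (\<Sum>e\<in>{e\<in>A. src e = v}. g e) = (\<Sum>e\<in>{e\<in>A. tgt e = v}. g e))"

text \<open>A node cannot balance with exactly one fractional arc end, so there are at least as many
  fractional arcs as nodes they touch. The conservation equations sum to zero, so one of them may be
  dropped; the others are fewer than the unknowns and have a nonzero solution.\<close>

lemma fractional_circulation_direction:
  fixes g :: "'e \<Rightarrow> real" and src tgt :: "'e \<Rightarrow> 'v"
  assumes A: "finite A" and circ: "circulation A src tgt g"
    and F: "F = {e\<in>A. g e \<notin> \<int>}" and "F \<noteq> {}"
  shows "\<exists>w. (\<exists>e\<in>F. w e \<noteq> 0) \<and> (\<forall>e. e \<notin> F \<longrightarrow> w e = 0) \<and> circulation A src tgt w"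
proof -
  define N where "N = src ` F \<union> tgt ` F"
  have finF: "finite F" using A F by simp
  then have finN: "finite N" by (simp add: N_def)
  define O' where "O' v = {e\<in>F. src e = v}" for v
  define I' where "I' v = {e\<in>F. tgt e = v}" for v
  have finOI: "finite (O' v)" "finite (I' v)" for v using finF by (auto simp: O'_def I'_def)
  have frac_split: "(\<Sum>e\<in>{e\<in>A. p e}. g e) - (\<Sum>e\<in>{e\<in>F. p e}. g e) \<in> \<int>" for p
  proof -
    have "(\<Sum>e\<in>{e\<in>A. p e}. g e) - (\<Sum>e\<in>{e\<in>F. p e}. g e) = (\<Sum>e\<in>{e\<in>A. p e} - {e\<in>F. p e}. g e)"
      using A F by (subst sum_diff) auto
    also have "\<dots> \<in> \<int>" using F by (intro Ints_sum) auto
    finally show ?thesis .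
  qed
  have diffZ: "(\<Sum>e\<in>O' v. g e) - (\<Sum>e\<in>I' v. g e) \<in> \<int>" for v
  proof -
    have "(\<Sum>e\<in>{e\<in>A. src e = v}. g e) = (\<Sum>e\<in>{e\<in>A. tgt e = v}. g e)"
      using circ by (auto simp: circulation_def)
    then have "(\<Sum>e\<in>O' v. g e) - (\<Sum>e\<in>I' v. g e) =
       ((\<Sum>e\<in>{e\<in>A. tgt e = v}. g e) - (\<Sum>e\<in>I' v. g e)) - ((\<Sum>e\<in>{e\<in>A. src e = v}. g e) - (\<Sum>e\<in>O' v. g e))"
      by simp
    also have "\<dots> \<in> \<int>" unfolding O'_def I'_def by (intro Ints_diff frac_split)
    finally show ?thesis .
  qed
  have deg: "2 \<le> card (O' v) + card (I' v)" if "v \<in> N" for v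
  proof (rule ccontr)
    assume "\<not> ?thesis"
    moreover have "O' v \<noteq> {} \<or> I' v \<noteq> {}" using that by (auto simp: N_def O'_def I'_def)
    then have "card (O' v) + card (I' v) \<noteq> 0" using finOI by auto
    ultimately have "card (O' v) + card (I' v) = 1" by linarith
    then consider "card (O' v) = 1" "card (I' v) = 0" | "card (O' v) = 0" "card (I' v) = 1" by linarith
    then show False
    proof cases
      case 1
      then obtain e where "O' v = {e}" "I' v = {}" using finOI by (auto simp: card_1_singleton_iff)
      with diffZ[of v] have "g e \<in> \<int>" "e \<in> F" by (auto simp: O'_def)
      then show False using F by simp
    next
      case 2
      then obtain e where "I' v = {e}" "O' v = {}" using finOI by (auto simp: card_1_singleton_iff)
      with diffZ[of v] have "g e \<in> \<int>" "e \<in> F" by (auto simp: I'_def)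
      then show False using F by simp
    qed
  qed
  \<comment> \<open>Double counting of arc ends; a loop is counted once in \<open>O'\<close> and
    once in \<open>I'\<close>.\<close>
  have "2 * card N = (\<Sum>v\<in>N. 2)" by simp
  also have "\<dots> \<le> (\<Sum>v\<in>N. card (O' v) + card (I' v))" by (intro sum_mono deg)
  also have "\<dots> = (\<Sum>v\<in>N. card (O' v)) + (\<Sum>v\<in>N. card (I' v))" by (simp add: sum.distrib)
  also have "(\<Sum>v\<in>N. card (O' v)) = card F"
    using sum.group[OF finF finN, of src "\<lambda>_. 1::nat"] by (auto simp: O'_def N_def)
  also have "(\<Sum>v\<in>N. card (I' v)) = card F"
    using sum.group[OF finF finN, of tgt "\<lambda>_. 1::nat"] by (auto simp: I'_def N_def)
  finally have NF: "card N \<le> card F" by simp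
  obtain u where u: "u \<in> N" using \<open>F \<noteq> {}\<close> by (auto simp: N_def)
  have lt: "card (N - {u}) < card F" using NF u finN
    by (metis card_Diff1_less le_trans linorder_not_le)
  define c where "c v e = (if src e = v then 1 else 0) - (if tgt e = v then 1 else (0::real))" for v e
  from homogeneous_system_nontrivial[OF _ finF lt, of c] finN obtain w0 where
    w0: "\<exists>e\<in>F. w0 e \<noteq> 0" "\<And>v. v \<in> N - {u} \<Longrightarrow> (\<Sum>e\<in>F. c v e * w0 e) = 0" by auto
  define w where "w e = (if e \<in> F then w0 e else 0)" for e
  have FA: "F \<subseteq> A" using F by auto
  have net: "(\<Sum>e\<in>{e\<in>A. src e = v}. w e) - (\<Sum>e\<in>{e\<in>A. tgt e = v}. w e) = (\<Sum>e\<in>F. c v e * w0 e)" for v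
  proof -
    have *: "(\<Sum>e\<in>{e\<in>A. p e}. w e) = (\<Sum>e\<in>F. if p e then w0 e else 0)" for p
    proof -
      have "(\<Sum>e\<in>{e\<in>A. p e}. w e) = (\<Sum>e\<in>{e\<in>F. p e}. w0 e)"
        using A FA by (intro sum.mono_neutral_cong_right) (auto simp: w_def)
      then show ?thesis using finF by (simp add: sum.inter_filter)
    qed
    show ?thesis unfolding * sum_subtractf[symmetric] by (intro sum.cong) (auto simp: c_def)
  qed
  \<comment> \<open>Conservation at the omitted node \<open>u\<close>: the net flows of all nodes sum to zero.\<close>
  have "(\<Sum>v\<in>N. \<Sum>e\<in>F. c v e * w0 e) = (\<Sum>e\<in>F. \<Sum>v\<in>N. c v e * w0 e)" by (rule sum.swap)
  also have "\<dots> = 0"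
  proof (rule sum.neutral, rule ballI)
    fix e assume "e \<in> F"
    then have "src e \<in> N" "tgt e \<in> N" by (auto simp: N_def)
    then have "(\<Sum>v\<in>N. c v e) = 0" using finN by (simp add: c_def sum_subtractf)
    then have "(\<Sum>v\<in>N. c v e) * w0 e = 0" by simp
    then show "(\<Sum>v\<in>N. c v e * w0 e) = 0" by (simp only: sum_distrib_right)
  qed
  finally have "(\<Sum>e\<in>F. c u e * w0 e) = 0"
    using w0(2) finN u by (simp add: sum.remove[of N u])
  then have "(\<Sum>e\<in>F. c v e * w0 e) = 0" if "v \<in> N" for v using that w0(2) by (cases "v = u") auto
  moreover have "(\<Sum>e\<in>F. c v e * w0 e) = 0" if "v \<notin> N" for v
    using that by (intro sum.neutral) (auto simp: c_def N_def)
  ultimately have "circulation A src tgt w" unfolding circulation_def using net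
    by (metis eq_iff_diff_eq_0)
  then show ?thesis using w0(1) by (intro exI[of _ w]) (auto simp: w_def)
qed

text \<open>Moving along a direction supported on the fractional arcs until the first of them
  becomes integral keeps every arc between its original floor and ceiling and lowers the number of
  fractional arcs.\<close>

theorem circulation_rounding:
  fixes g :: "'e \<Rightarrow> real" and src tgt :: "'e \<Rightarrow> 'v"
  assumes A: "finite A" and "circulation A src tgt g"
  shows "\<exists>z::'e \<Rightarrow> int. (\<forall>e\<in>A. \<lfloor>g e\<rfloor> \<le> z e \<and> z e \<le> \<lceil>g e\<rceil>) \<and>
     (\<forall>v. (\<Sum>e\<in>{e\<in>A. src e = v}. z e) = (\<Sum>e\<in>{e\<in>A. tgt e = v}. z e))"
  using assms(2)
proof (induction "card {e\<in>A. g e \<notin> \<int>}" arbitrary: g rule: less_induct)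
  case less
  define F where "F = {e\<in>A. g e \<notin> \<int>}"
  show ?case
  proof (cases "F = {}")
    case True
    then have eq: "of_int \<lfloor>g e\<rfloor> = g e" if "e \<in> A" for e using that by (auto simp: F_def elim: Ints_cases)
    have floor_sum: "(\<Sum>e\<in>{e\<in>A. P e}. real_of_int \<lfloor>g e\<rfloor>) = (\<Sum>e\<in>{e\<in>A. P e}. g e)" for P
      by (intro sum.cong refl) (simp add: eq)
    have "(\<Sum>e\<in>{e\<in>A. src e = v}. \<lfloor>g e\<rfloor>) = (\<Sum>e\<in>{e\<in>A. tgt e = v}. \<lfloor>g e\<rfloor>)" for v
    proof -
      have "(\<Sum>e\<in>{e\<in>A. src e = v}. g e) = (\<Sum>e\<in>{e\<in>A. tgt e = v}. g e)"
        using less.prems by (auto simp: circulation_def)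
      then have "(\<Sum>e\<in>{e\<in>A. src e = v}. real_of_int \<lfloor>g e\<rfloor>) = (\<Sum>e\<in>{e\<in>A. tgt e = v}. real_of_int \<lfloor>g e\<rfloor>)"
        by (simp only: floor_sum)
      then have "real_of_int (\<Sum>e\<in>{e\<in>A. src e = v}. \<lfloor>g e\<rfloor>) = real_of_int (\<Sum>e\<in>{e\<in>A. tgt e = v}. \<lfloor>g e\<rfloor>)"
        by simp
      then show ?thesis by linarith
    qed
    then show ?thesis by (intro exI[of _ "\<lambda>e. \<lfloor>g e\<rfloor>"]) (auto simp: floor_le_ceiling)
  next
    case False
    from fractional_circulation_direction[OF A less.prems F_def False] obtain w where
      w: "\<exists>e\<in>F. w e \<noteq> 0" "\<And>e. e \<notin> F \<Longrightarrow> w e = 0" "circulation A src tgt w" by blast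
    \<comment> \<open>\<open>b e\<close> is the integer that arc \<open>e\<close> approaches,
      \<open>T\<close> contains the arrival times of the moving arcs, and \<open>t\<close> is the
      earliest arrival.\<close>
    define b where "b e = (if w e > 0 then real_of_int \<lceil>g e\<rceil> else of_int \<lfloor>g e\<rfloor>)" for e
    define T where "T = (\<lambda>e. (b e - g e) / w e) ` {e\<in>F. w e \<noteq> 0}"
    have finF: "finite F" using A by (simp add: F_def)
    have T: "finite T" "T \<noteq> {}" using finF w(1) by (auto simp: T_def)
    define t where "t = Min T"
    have "t \<in> T" using T by (simp add: t_def)
    then obtain e0 where e0: "e0 \<in> F" "w e0 \<noteq> 0" "t = (b e0 - g e0) / w e0" by (auto simp: T_def)
    have frac: "of_int \<lfloor>g e\<rfloor> < g e \<and> g e < of_int \<lceil>g e\<rceil>" if "e \<in> F" for e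
    proof -
      have "g e \<noteq> of_int \<lfloor>g e\<rfloor>" "g e \<noteq> of_int \<lceil>g e\<rceil>" using that
        by (auto simp: F_def) (metis Ints_of_int)+
      then show ?thesis by (metis le_of_int_ceiling less_le of_int_floor_le)
    qed
    have tpos: "0 \<le> t"
      using e0 frac[OF e0(1)] by (auto simp: b_def zero_le_divide_iff)
    have tle: "t \<le> (b e - g e) / w e" if "e \<in> F" "w e \<noteq> 0" for e
      unfolding t_def using T that by (intro Min_le) (auto simp: T_def)
    define g' where "g' e = g e + t * w e" for e
    have bound: "of_int \<lfloor>g e\<rfloor> \<le> g' e \<and> g' e \<le> of_int \<lceil>g e\<rceil>" if "e \<in> A" for e
    proof -
      consider "w e = 0" | "w e > 0" "e \<in> F" | "w e < 0" "e \<in> F" using w(2) by (metis linorder_less_linear)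
      then show ?thesis
      proof cases
        case 1 then show ?thesis by (simp add: g'_def)
      next
        case 2
        then have "t * w e \<le> of_int \<lceil>g e\<rceil> - g e" using tle[of e] by (simp add: b_def pos_le_divide_eq)
        moreover have "0 \<le> t * w e" using tpos 2 by simp
        ultimately show ?thesis unfolding g'_def using of_int_floor_le[of "g e"] by linarith
      next
        case 3
        then have "t * w e \<ge> of_int \<lfloor>g e\<rfloor> - g e" using tle[of e] by (simp add: b_def neg_le_divide_eq)
        moreover have "t * w e \<le> 0" using tpos 3 by (simp add: mult_nonneg_nonpos)
        ultimately show ?thesis unfolding g'_def using le_of_int_ceiling[of "g e"] by linarith
      qed
    qed
    have circ': "circulation A src tgt g'"
      using less.prems w(3) by (simp add: circulation_def g'_def sum.distrib sum_distrib_left[symmetric])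
    have "g' e0 = b e0" using e0 by (simp add: g'_def)
    then have "g' e0 \<in> \<int>" by (simp add: b_def)
    moreover have "g' e = g e" if "e \<notin> F" for e using w(2)[OF that] by (simp add: g'_def)
    ultimately have "{e\<in>A. g' e \<notin> \<int>} \<subset> F"
      using e0(1) unfolding F_def by auto
    then have "card {e\<in>A. g' e \<notin> \<int>} < card {e\<in>A. g e \<notin> \<int>}"
      using finF psubset_card_mono unfolding F_def by blast
    from less.hyps[OF this circ'] obtain z :: "'e \<Rightarrow> int" where
      z: "\<And>e. e\<in>A \<Longrightarrow> \<lfloor>g' e\<rfloor> \<le> z e \<and> z e \<le> \<lceil>g' e\<rceil>"
      "\<forall>v. (\<Sum>e\<in>{e\<in>A. src e = v}. z e) = (\<Sum>e\<in>{e\<in>A. tgt e = v}. z e)" by auto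
    have "\<lfloor>g e\<rfloor> \<le> z e \<and> z e \<le> \<lceil>g e\<rceil>" if "e \<in> A" for e
      using z(1)[OF that] bound[OF that] by (meson ceiling_le_iff le_floor_iff order_trans)
    then show ?thesis using z(2) by blast
  qed
qed

section \<open>Fair shares\<close>

text \<open>For \<open>f \<ge> 1\<close> the bounds are floor and ceiling of \<open>N / f\<close>,
  written in natural numbers so that hinge counting stays free of real casts.\<close>

definition fair :: "nat \<Rightarrow> nat \<Rightarrow> nat \<Rightarrow> bool" where
  "fair f N z \<longleftrightarrow> N div f \<le> z \<and> z \<le> (N + f - 1) div f"

lemma fairI_real:
  fixes z :: int
  assumes "f \<ge> 1" and "\<lfloor>real N / real f\<rfloor> \<le> z" and "z \<le> \<lceil>real N / real f\<rceil>"
  shows "fair f N (nat z)" and "z \<ge> 0"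
proof -
  have fl: "\<lfloor>real N / real f\<rfloor> = int (N div f)"
    by (rule floor_divide_of_nat_eq)
  show "z \<ge> 0" using assms(2) unfolding fl by linarith
  have "\<lceil>real N / real f\<rceil> \<le> int ((N + f - 1) div f)"
  proof -
    have "N \<le> (N + f - 1) div f * f"
    proof -
      have "(N + f - 1) mod f < f" using assms(1) by simp
      then show ?thesis using div_mult_mod_eq[of "N + f - 1" f] by linarith
    qed
    then have "real N \<le> real ((N + f - 1) div f) * real f"
      unfolding of_nat_mult[symmetric] of_nat_le_iff .
    then have "real N / real f \<le> real_of_int (int ((N + f - 1) div f))"
      using assms(1) by (simp add: divide_le_eq)
    then show ?thesis by (simp only: ceiling_le_iff)
  qed
  then have "z \<le> int ((N + f - 1) div f)" using assms(3) by linarith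
  moreover have "int (N div f) \<le> z" using assms(2) fl by linarith
  ultimately show "fair f N (nat z)" unfolding fair_def by linarith
qed

lemma fair_approx: "f \<ge> 1 \<Longrightarrow> fair f N z \<Longrightarrow> approx (real z) (real N / real f)"
proof -
  assume f: "f \<ge> 1" "fair f N z"
  have "\<lfloor>real N / real f\<rfloor> = int (N div f)"
    by (rule floor_divide_of_nat_eq)
  moreover have "int z \<le> \<lceil>real N / real f\<rceil>"
  proof -
    have "z \<le> (N + f - 1) div f" using f by (simp add: fair_def)
    then have "z * f \<le> N + f - 1" using f(1) by (simp add: less_eq_div_iff_mult_less_eq)
    then have "z * f < N + f" using f(1) by linarith
    then have "real z * real f < real N + real f" by (metis of_nat_add of_nat_less_iff of_nat_mult)
    then have "real z - 1 < real N / real f" using f(1) by (simp add: field_simps)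
    then show ?thesis by linarith
  qed
  moreover have "N div f \<le> z" using f(2) by (simp add: fair_def)
  ultimately show ?thesis unfolding approx_def by simp
qed

lemma mult_add_pred_div: "f \<ge> 1 \<Longrightarrow> (f * q + f - 1) div f = (q::nat)"
  by (rule div_nat_eqI) auto

text \<open>Divisibility removes all freedom of rounding; this turns fair trace totals into exact
  ones, and makes the last vertex (\<open>f = 1\<close>) take every remaining hinge.\<close>

lemma fair_dvd: "f \<ge> 1 \<Longrightarrow> fair f (f * q) z \<longleftrightarrow> z = q"
  using mult_add_pred_div[of f q] by (auto simp: fair_def)

lemma fair_0: "f \<ge> 1 \<Longrightarrow> fair f 0 z \<longleftrightarrow> z = 0"
  using fair_dvd[of f 0 z] by simp

text \<open>With \<open>x\<close> hyperedges of \<open>r\<close> hinges each and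
  \<open>r \<le> f\<close>, the share is at most one hinge per hyperedge, so no hyperedge has to
  contain the new vertex twice.\<close>

lemma fair_le_mult: "f \<ge> 1 \<Longrightarrow> fair f (x * r) z \<Longrightarrow> r \<le> f \<Longrightarrow> z \<le> x"
proof -
  assume a: "f \<ge> 1" "fair f (x * r) z" "r \<le> f"
  have "(x * r + f - 1) div f \<le> (f * x + f - 1) div f"
    using a(3) by (intro div_le_mono diff_le_mono) (simp add: mult.commute)
  also have "\<dots> = x" using mult_add_pred_div a(1) .
  finally show ?thesis using a(2) by (simp add: fair_def)
qed

lemma fair_le: "f \<ge> 1 \<Longrightarrow> fair f N z \<Longrightarrow> z \<le> N"
  using fair_le_mult[of f N 1 z] by simp

lemma fair_pos: "f \<ge> 1 \<Longrightarrow> fair f N z \<Longrightarrow> f \<le> N \<Longrightarrow> 1 \<le> z"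
  using div_le_mono[of f N f] by (simp add: fair_def)

text \<open>For \<open>N \<ge> 1\<close> the ceiling of \<open>N / f\<close> is
  \<open>(N - 1) div f + 1\<close>. One hinge attaches a block to the new vertex; the surplus is
  what is bounded here.\<close>

lemma fair_pred:
  assumes "f \<ge> 1" and "fair f N z" and "N \<ge> 1"
  shows "z - 1 \<le> (N - 1) div f"
proof -
  obtain M where M: "N = Suc M" using assms(3) by (cases N) auto
  have "z \<le> (M + f) div f" using assms(2) by (simp add: fair_def M)
  then show ?thesis using assms(1) by (simp add: M)
qed

text \<open>If an average over \<open>f\<close> vertices lies between the integers \<open>lo\<close>
  and \<open>hi\<close>, then so does a fair share, and so does the average left for the other
  \<open>f - 1\<close> vertices. This lets the same degree bounds serve at every step.\<close>

lemma fair_step: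
  assumes "f \<ge> 1" and "fair f d z" and "f * lo \<le> d" and "d \<le> f * hi"
  shows "lo \<le> z" and "z \<le> hi" and "(f - 1) * lo \<le> d - z" and "d - z \<le> (f - 1) * hi"
proof -
  define q r where "q = d div f" and "r = d mod f"
  have d: "d = f * q + r" "r < f" using assms(1) by (auto simp: q_def r_def)
  have lo: "lo \<le> q" using assms(1,3) by (simp add: q_def less_eq_div_iff_mult_less_eq mult.commute)
  have zq: "q \<le> z" using assms(2) by (simp add: fair_def q_def)
  show "lo \<le> z" using lo zq by simp
  obtain f' where f': "f = Suc f'" using assms(1) by (cases f) auto
  show "z \<le> hi" "(f - 1) * lo \<le> d - z" "d - z \<le> (f - 1) * hi"
  proof -
    have "z \<le> (f * hi + f - 1) div f"
      using assms(2,4) div_le_mono[of "d + f - 1" "f * hi + f - 1" f]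
      unfolding fair_def by linarith
    then show "z \<le> hi" using mult_add_pred_div[OF assms(1)] by simp
    show "(f - 1) * lo \<le> d - z"
    proof (cases "r = 0")
      case True
      then have "z = q" using fair_dvd assms(1,2) d by simp
      then show ?thesis using True d lo f' by simp
    next
      case False
      then have "z - 1 \<le> (d - 1) div f" using d assms by (intro fair_pred) auto
      also have "(d - 1) div f \<le> q" unfolding q_def by (intro div_le_mono) simp
      finally have "z \<le> q + 1" by simp
      \<comment> \<open>The nonzero remainder \<open>r\<close> pays for the unit by which
        \<open>z\<close> may exceed \<open>q\<close>.\<close>
      then have step: "f' * q \<le> d - z" using False d f' by simp
      have "f' * lo \<le> f' * q" using lo by (rule mult_le_mono2)
      then have "f' * lo \<le> d - z" using step by (rule le_trans)
      then show ?thesis using f' by simp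
    qed
    show "d - z \<le> (f - 1) * hi"
    proof (cases "r = 0")
      case True
      then have "q \<le> hi" using assms d by simp
      then have "f' * q \<le> f' * hi" by (rule mult_le_mono2)
      moreover have "d - z \<le> f' * q" using True d zq f' by simp
      ultimately have "d - z \<le> f' * hi" by (rule le_trans[rotated])
      then show ?thesis using f' by simp
    next
      case False
      have "q < hi"
      proof (rule ccontr)
        assume "\<not> q < hi"
        then have "f * hi \<le> f * q" by simp
        then show False using assms d False by linarith
      qed
      then have "f' * (q + 1) \<le> f' * hi" by (intro mult_le_mono2) simp
      then show ?thesis using d zq f' by simp
    qed
  qed
qed

section \<open>Simultaneous fair rounding on two laminar structures\<close>

lemma sum_over_image_blocks:
  assumes "finite E"
  shows "(\<Sum>d\<in>{d\<in>b ` E. t d = c}. \<Sum>e\<in>{e\<in>E. b e = d}. u e) = (\<Sum>e\<in>{e\<in>E. t (b e) = c}. u e)"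
proof -
  have "(\<Sum>d\<in>{d\<in>b ` E. t d = c}. \<Sum>e\<in>{e\<in>E. b e = d}. u e)
      = (\<Sum>d\<in>{d\<in>b ` E. t d = c}. \<Sum>e\<in>{e\<in>{e\<in>E. t (b e) = c}. b e = d}. u e)"
    by (rule sum.cong[OF refl], rule sum.cong) auto
  also have "\<dots> = (\<Sum>e\<in>{e\<in>E. t (b e) = c}. u e)" using assms by (intro sum.group) auto
  finally show ?thesis .
qed

datatype ('e, 'p, 'q, 'r, 's) laminar_arc = Elem 'e | PArc 'p | QArc 'q | RArc 'r | SArc 's
datatype ('p, 'q, 'r, 's) laminar_node = Hub | PNode 'p | QNode 'q | RNode 'r | SNode 's

text \<open>The circulation runs from the hub through the blocks of \<open>p\<close>, then through the elements, and
  back to the hub through the blocks of the successively coarser partitions \<open>q\<close>, \<open>r \<circ> q\<close> and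
  \<open>s \<circ> r \<circ> q\<close>, so every block total is the value of an arc.\<close>

theorem fair_rounding:
  fixes p :: "'e \<Rightarrow> 'p" and q :: "'e \<Rightarrow> 'q" and r :: "'q \<Rightarrow> 'r" and s :: "'r \<Rightarrow> 's" and N :: "'e \<Rightarrow> nat"
  assumes E: "finite E" and f: "f \<ge> 1"
  shows "\<exists>z :: 'e \<Rightarrow> nat. (\<forall>e\<in>E. fair f (N e) (z e)) \<and>
    (\<forall>c. fair f (\<Sum>e\<in>{e\<in>E. p e = c}. N e) (\<Sum>e\<in>{e\<in>E. p e = c}. z e)) \<and>
    (\<forall>c. fair f (\<Sum>e\<in>{e\<in>E. q e = c}. N e) (\<Sum>e\<in>{e\<in>E. q e = c}. z e)) \<and>
    (\<forall>c. fair f (\<Sum>e\<in>{e\<in>E. r (q e) = c}. N e) (\<Sum>e\<in>{e\<in>E. r (q e) = c}. z e)) \<and>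
    (\<forall>c. fair f (\<Sum>e\<in>{e\<in>E. s (r (q e)) = c}. N e) (\<Sum>e\<in>{e\<in>E. s (r (q e)) = c}. z e))"
proof -
  define A :: "('e,'p,'q,'r,'s) laminar_arc set" where
    "A = Elem ` E \<union> PArc ` p ` E \<union> QArc ` q ` E \<union> RArc ` r ` q ` E \<union> SArc ` s ` r ` q ` E"
  define src :: "('e,'p,'q,'r,'s) laminar_arc \<Rightarrow> ('p,'q,'r,'s) laminar_node" where
    "src a = (case a of Elem e \<Rightarrow> PNode (p e) | PArc c \<Rightarrow> Hub | QArc c \<Rightarrow> QNode c
       | RArc c \<Rightarrow> RNode c | SArc c \<Rightarrow> SNode c)" for a
  define tgt :: "('e,'p,'q,'r,'s) laminar_arc \<Rightarrow> ('p,'q,'r,'s) laminar_node" where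
    "tgt a = (case a of Elem e \<Rightarrow> QNode (q e) | PArc c \<Rightarrow> PNode c | QArc c \<Rightarrow> RNode (r c)
       | RArc c \<Rightarrow> SNode (s c) | SArc c \<Rightarrow> Hub)" for a
  define y where "y e = real (N e) / real f" for e
  define g :: "('e,'p,'q,'r,'s) laminar_arc \<Rightarrow> real" where
    "g a = (case a of Elem e \<Rightarrow> y e | PArc c \<Rightarrow> (\<Sum>e\<in>{e\<in>E. p e = c}. y e)
       | QArc c \<Rightarrow> (\<Sum>e\<in>{e\<in>E. q e = c}. y e) | RArc c \<Rightarrow> (\<Sum>e\<in>{e\<in>E. r (q e) = c}. y e)
       | SArc c \<Rightarrow> (\<Sum>e\<in>{e\<in>E. s (r (q e)) = c}. y e))" for a
  have finA: "finite A" using E by (simp add: A_def)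
  have out: "{a\<in>A. src a = PNode c} = Elem ` {e\<in>E. p e = c}"
    "{a\<in>A. src a = QNode c'} = (if c' \<in> q ` E then {QArc c'} else {})"
    "{a\<in>A. src a = RNode c''} = (if c'' \<in> r ` q ` E then {RArc c''} else {})"
    "{a\<in>A. src a = SNode c'''} = (if c''' \<in> s ` r ` q ` E then {SArc c'''} else {})"
    "{a\<in>A. src a = Hub} = PArc ` p ` E" for c c' c'' c'''
    by (auto simp: A_def src_def)
  have inn: "{a\<in>A. tgt a = PNode c} = (if c \<in> p ` E then {PArc c} else {})"
    "{a\<in>A. tgt a = QNode c'} = Elem ` {e\<in>E. q e = c'}"
    "{a\<in>A. tgt a = RNode c''} = QArc ` {d \<in> q ` E. r d = c''}"
    "{a\<in>A. tgt a = SNode c'''} = RArc ` {d \<in> r ` q ` E. s d = c'''}"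
    "{a\<in>A. tgt a = Hub} = SArc ` s ` r ` q ` E" for c c' c'' c'''
    by (auto simp: A_def tgt_def)
  have inj: "inj_on Elem X1" "inj_on PArc X2" "inj_on QArc X3" "inj_on RArc X4" "inj_on SArc X5"
    for X1 :: "'e set" and X2 :: "'p set" and X3 :: "'q set" and X4 :: "'r set" and X5 :: "'s set"
    by (auto simp: inj_on_def)
  note group = sum_over_image_blocks[OF E]
  have none: "c \<notin> b ` E \<Longrightarrow> {e\<in>E. b e = c} = {}" for b :: "'e \<Rightarrow> 'x" and c by auto
  have "circulation A src tgt g"
    unfolding circulation_def
  proof
    fix v
    have eE: "(\<Sum>e\<in>p ` E. g (PArc e)) = (\<Sum>e\<in>E. y e)" "(\<Sum>e\<in>s ` r ` q ` E. g (SArc e)) = (\<Sum>e\<in>E. y e)"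
      using sum.image_gen[OF E, of y p] sum.image_gen[OF E, of y "\<lambda>e. s (r (q e))"] unfolding image_image by (simp_all add: g_def)
    show "(\<Sum>a\<in>{a\<in>A. src a = v}. g a) = (\<Sum>a\<in>{a\<in>A. tgt a = v}. g a)"
    proof (cases v)
      case Hub
      have "(\<Sum>a\<in>{a\<in>A. src a = Hub}. g a) = (\<Sum>c\<in>p ` E. g (PArc c))"
        unfolding out by (simp only: sum.reindex[OF inj(2)] o_def)
      moreover have "(\<Sum>a\<in>{a\<in>A. tgt a = Hub}. g a) = (\<Sum>c\<in>s ` r ` q ` E. g (SArc c))"
        unfolding inn by (simp only: sum.reindex[OF inj(5)] o_def)
      ultimately show ?thesis using eE by (simp only: Hub)
    next
      case (PNode c)
      have "(\<Sum>a\<in>{a\<in>A. src a = PNode c}. g a) = (\<Sum>e\<in>{e\<in>E. p e = c}. y e)"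
        unfolding out by (simp add: sum.reindex[OF inj(1)] g_def o_def)
      then show ?thesis unfolding PNode inn using none[of c p]
        by (cases "c \<in> p ` E") (simp_all add: g_def)
    next
      case (QNode c)
      have "(\<Sum>a\<in>{a\<in>A. tgt a = QNode c}. g a) = (\<Sum>e\<in>{e\<in>E. q e = c}. y e)"
        unfolding inn by (simp add: sum.reindex[OF inj(1)] g_def o_def)
      then show ?thesis unfolding QNode out using none[of c q]
        by (cases "c \<in> q ` E") (simp_all add: g_def)
    next
      case (RNode c)
      have "(\<Sum>a\<in>{a\<in>A. tgt a = RNode c}. g a) = (\<Sum>d\<in>{d\<in>q ` E. r d = c}. \<Sum>e\<in>{e\<in>E. q e = d}. y e)"
        unfolding inn by (simp add: sum.reindex[OF inj(3)] g_def o_def)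
      also have "\<dots> = (\<Sum>e\<in>{e\<in>E. r (q e) = c}. y e)" by (rule group)
      finally show ?thesis unfolding RNode out image_image using none[of c "\<lambda>e. r (q e)"]
        by (cases "c \<in> (\<lambda>e. r (q e)) ` E") (simp_all add: g_def)
    next
      case (SNode c)
      have "(\<Sum>a\<in>{a\<in>A. tgt a = SNode c}. g a)
          = (\<Sum>d\<in>{d\<in>(\<lambda>e. r (q e)) ` E. s d = c}. \<Sum>e\<in>{e\<in>E. r (q e) = d}. y e)"
        unfolding inn image_image by (simp add: sum.reindex[OF inj(4)] g_def o_def)
      also have "\<dots> = (\<Sum>e\<in>{e\<in>E. s (r (q e)) = c}. y e)" by (rule group)
      finally show ?thesis unfolding SNode out image_image using none[of c "\<lambda>e. s (r (q e))"]
        by (cases "c \<in> (\<lambda>e. s (r (q e))) ` E") (simp_all add: g_def)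
    qed
  qed
  from circulation_rounding[OF finA this] obtain Z :: "('e,'p,'q,'r,'s) laminar_arc \<Rightarrow> int" where
    Z: "\<And>a. a \<in> A \<Longrightarrow> \<lfloor>g a\<rfloor> \<le> Z a \<and> Z a \<le> \<lceil>g a\<rceil>"
    and cons: "\<And>v. (\<Sum>a\<in>{a\<in>A. src a = v}. Z a) = (\<Sum>a\<in>{a\<in>A. tgt a = v}. Z a)" by auto
  define z where "z e = nat (Z (Elem e))" for e
  have elem: "fair f (N e) (z e) \<and> int (z e) = Z (Elem e)" if "e \<in> E" for e
    using Z[of "Elem e"] that fairI_real[OF f, of "N e" "Z (Elem e)"] by (auto simp: A_def g_def y_def z_def)
  have P: "(\<Sum>e\<in>{e\<in>E. p e = c}. Z (Elem e)) = Z (PArc c)" if "c \<in> p ` E" for c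
    using cons[of "PNode c"] that by (simp add: out inn sum.reindex[OF inj(1)])
  have Q: "(\<Sum>e\<in>{e\<in>E. q e = c}. Z (Elem e)) = Z (QArc c)" if "c \<in> q ` E" for c
    using cons[of "QNode c"] that by (simp add: out inn sum.reindex[OF inj(1)])
  have R: "(\<Sum>e\<in>{e\<in>E. r (q e) = c}. Z (Elem e)) = Z (RArc c)" if "c \<in> r ` q ` E" for c
  proof -
    have "Z (RArc c) = (\<Sum>d\<in>{d\<in>q ` E. r d = c}. Z (QArc d))"
      using cons[of "RNode c"] that unfolding out inn by (simp add: sum.reindex[OF inj(3)])
    also have "\<dots> = (\<Sum>d\<in>{d\<in>q ` E. r d = c}. \<Sum>e\<in>{e\<in>E. q e = d}. Z (Elem e))"
      by (rule sum.cong[OF refl]) (simp add: Q)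
    also have "\<dots> = (\<Sum>e\<in>{e\<in>E. r (q e) = c}. Z (Elem e))" by (rule group)
    finally show ?thesis ..
  qed
  have S: "(\<Sum>e\<in>{e\<in>E. s (r (q e)) = c}. Z (Elem e)) = Z (SArc c)" if "c \<in> s ` r ` q ` E" for c
  proof -
    have "Z (SArc c) = (\<Sum>d\<in>{d\<in>r ` q ` E. s d = c}. Z (RArc d))"
      using cons[of "SNode c"] that unfolding out inn by (simp add: sum.reindex[OF inj(4)])
    also have "\<dots> = (\<Sum>d\<in>{d\<in>r ` q ` E. s d = c}. \<Sum>e\<in>{e\<in>E. r (q e) = d}. Z (Elem e))"
      by (rule sum.cong[OF refl]) (simp add: R)
    also have "\<dots> = (\<Sum>e\<in>{e\<in>E. s (r (q e)) = c}. Z (Elem e))"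
      unfolding image_image by (rule group)
    finally show ?thesis ..
  qed
  \<comment> \<open>A label outside the image has no arc, but both of its sums are empty and
    \<open>0\<close> is a fair share of \<open>0\<close>; hence fairness can be stated for all
    labels.\<close>
  have block: "fair f (\<Sum>e\<in>{e\<in>E. B e}. N e) (\<Sum>e\<in>{e\<in>E. B e}. z e)"
    if "\<exists>e\<in>E. B e \<Longrightarrow> (\<Sum>e\<in>{e\<in>E. B e}. Z (Elem e)) = Z arc \<and> arc \<in> A \<and> g arc = (\<Sum>e\<in>{e\<in>E. B e}. y e)"
    for B arc
  proof (cases "\<exists>e\<in>E. B e")
    case True
    have "g arc = real (\<Sum>e\<in>{e\<in>E. B e}. N e) / real f"
      using that[OF True] by (simp add: y_def sum_divide_distrib)
    moreover have "(\<Sum>e\<in>{e\<in>E. B e}. Z (Elem e)) = (\<Sum>e\<in>{e\<in>E. B e}. int (z e))"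
      by (rule sum.cong[OF refl]) (simp add: elem)
    then have "Z arc = int (\<Sum>e\<in>{e\<in>E. B e}. z e)" using that[OF True] by simp
    ultimately show ?thesis using fairI_real(1)[OF f, of "\<Sum>e\<in>{e\<in>E. B e}. N e" "Z arc"] Z[of arc] that[OF True]
      by (simp only: nat_int)
  next
    case False
    then have "{e\<in>E. B e} = {}" by auto
    then show ?thesis using fair_0[OF f] by (simp only: sum.empty)
  qed
  show ?thesis
  proof (intro exI[of _ z] conjI allI ballI)
    show "fair f (N e) (z e)" if "e \<in> E" for e using elem that by blast
    show "fair f (\<Sum>e\<in>{e\<in>E. p e = c}. N e) (\<Sum>e\<in>{e\<in>E. p e = c}. z e)" for c
      by (rule block[of "\<lambda>e. p e = c" "PArc c"]) (intro conjI P; force simp: A_def g_def)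
    show "fair f (\<Sum>e\<in>{e\<in>E. q e = c}. N e) (\<Sum>e\<in>{e\<in>E. q e = c}. z e)" for c
      by (rule block[of "\<lambda>e. q e = c" "QArc c"]) (intro conjI Q; force simp: A_def g_def)
    show "fair f (\<Sum>e\<in>{e\<in>E. r (q e) = c}. N e) (\<Sum>e\<in>{e\<in>E. r (q e) = c}. z e)" for c
      by (rule block[of "\<lambda>e. r (q e) = c" "RArc c"]) (intro conjI R; force simp: A_def g_def)
    show "fair f (\<Sum>e\<in>{e\<in>E. s (r (q e)) = c}. N e) (\<Sum>e\<in>{e\<in>E. s (r (q e)) = c}. z e)" for c
      by (rule block[of "\<lambda>e. s (r (q e)) = c" "SArc c"]) (intro conjI S; force simp: A_def g_def)
  qed
qed

section \<open>Connectivity of a partially split class\<close>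

text \<open>The empty trace lies in every \<open>Pow C\<close>, but its hyperedges are components of
  their own and belong to no block.\<close>

definition hinges :: "nat \<Rightarrow> ('a set \<Rightarrow> nat) \<Rightarrow> 'a set \<Rightarrow> nat" where
  "hinges h x C = (\<Sum>S\<in>Pow C - {{}}. x S * (h - card S))"

definition shares :: "('a set \<Rightarrow> nat) \<Rightarrow> 'a \<Rightarrow> 'a \<Rightarrow> bool" where
  "shares x u w \<longleftrightarrow> (\<exists>S. x S > 0 \<and> u \<in> S \<and> w \<in> S)"

text \<open>The set \<open>W\<close> holds the vertices already split off, \<open>x S\<close> counts the hyperedges of one class with
  trace \<open>S\<close> on \<open>W\<close>, and \<open>f\<close> vertices are still amalgamated. A hyperedge of trace \<open>S\<close> meets the amalgamated
  vertex in \<open>h - card S\<close> hinges, and the components (in the incidence graph) left after deleting that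
  vertex are the blocks of \<open>P\<close> together with every single hyperedge of empty trace, which has \<open>h\<close> hinges.
  The final inequality is the count of edges minus vertices necessary for joining these components
  through \<open>f\<close> vertices.\<close>

definition connectable :: "nat \<Rightarrow> nat \<Rightarrow> 'a set \<Rightarrow> ('a set \<Rightarrow> nat) \<Rightarrow> 'a set set \<Rightarrow> bool" where
  "connectable h f W x P \<longleftrightarrow> partition_on W P \<and>
     (\<forall>S. S \<noteq> {} \<longrightarrow> x S > 0 \<longrightarrow> (\<exists>C\<in>P. S \<subseteq> C)) \<and>
     (\<forall>C\<in>P. \<forall>u\<in>C. \<forall>w\<in>C. (shares x)\<^sup>*\<^sup>* u w) \<and>
     (if f = 0 then card P \<le> 1
      else (\<forall>C\<in>P. 1 \<le> hinges h x C) \<and> f - 1 \<le> (\<Sum>C\<in>P. hinges h x C - 1) + (h - 1) * x {})"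

text \<open>Here \<open>y S\<close> of the hyperedges with trace \<open>S\<close> give one hinge to the new vertex \<open>v\<close>.\<close>

definition split_vertex :: "'a \<Rightarrow> ('a set \<Rightarrow> nat) \<Rightarrow> ('a set \<Rightarrow> nat) \<Rightarrow> 'a set \<Rightarrow> nat" where
  "split_vertex v x y S = (if v \<in> S then y (S - {v}) else x S - y S)"

text \<open>Disjoint blocks have no nonempty subset in common, and sets that straddle several blocks
  contribute zero.\<close>

lemma sum_nonempty_subsets_blocks:
  fixes g :: "'a set \<Rightarrow> nat"
  assumes "finite (\<Union>P)" and "disjoint P"
    and "\<And>S. S \<noteq> {} \<Longrightarrow> S \<subseteq> \<Union>P \<Longrightarrow> g S \<noteq> 0 \<Longrightarrow> \<exists>C\<in>P. S \<subseteq> C"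
  shows "(\<Sum>S\<in>Pow (\<Union>P) - {{}}. g S) = (\<Sum>C\<in>P. \<Sum>S\<in>Pow C - {{}}. g S)"
proof -
  have finP: "finite P" using assms(1) by (rule finite_UnionD)
  have finC: "finite (Pow C - {{}})" if "C \<in> P" for C
    using assms(1) that by (meson Union_upper finite_Diff finite_Pow_iff finite_subset)
  have disj: "(Pow C - {{}}) \<inter> (Pow C' - {{}}) = {}" if "C \<in> P" "C' \<in> P" "C \<noteq> C'" for C C'
  proof -
    have "C \<inter> C' = {}" using assms(2) that by (rule disjointD)
    then show ?thesis by blast
  qed
  have "(\<Sum>C\<in>P. \<Sum>S\<in>Pow C - {{}}. g S) = (\<Sum>S\<in>(\<Union>C\<in>P. Pow C - {{}}). g S)"
    using finP finC disj by (intro sum.UNION_disjoint[symmetric]) auto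
  also have "\<dots> = (\<Sum>S\<in>Pow (\<Union>P) - {{}}. g S)"
  proof (rule sum.mono_neutral_left)
    show "\<forall>S\<in>Pow (\<Union>P) - {{}} - (\<Union>C\<in>P. Pow C - {{}}). g S = 0" using assms(3) by blast
  qed (use assms(1) in auto)
  finally show ?thesis ..
qed

text \<open>The separate term \<open>g {v}\<close> accounts for hyperedges whose trace was empty
  before \<open>v\<close> was split off.\<close>

lemma sum_nonempty_subsets_insert:
  fixes g :: "'a set \<Rightarrow> nat"
  assumes "finite U" and "v \<notin> U"
  shows "(\<Sum>S\<in>Pow (insert v U) - {{}}. g S) = (\<Sum>S\<in>Pow U - {{}}. g S + g (insert v S)) + g {v}"
proof -
  have "Pow (insert v U) - {{}} = (Pow U - {{}}) \<union> insert v ` Pow U"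
    by (auto simp: Pow_insert)
  moreover have "(Pow U - {{}}) \<inter> insert v ` Pow U = {}" using assms(2) by auto
  ultimately have "(\<Sum>S\<in>Pow (insert v U) - {{}}. g S)
      = (\<Sum>S\<in>Pow U - {{}}. g S) + (\<Sum>S\<in>insert v ` Pow U. g S)"
    using assms(1) by (simp add: sum.union_disjoint)
  also have "inj_on (insert v) (Pow U)" using assms(2) by (auto simp: inj_on_def insert_ident)
  then have "(\<Sum>S\<in>insert v ` Pow U. g S) = (\<Sum>S\<in>Pow U. g (insert v S))"
    by (simp add: sum.reindex)
  also have "\<dots> = (\<Sum>S\<in>Pow U - {{}}. g (insert v S)) + g {v}"
    using assms(1) by (subst sum.remove[of _ "{}"]) auto
  finally show ?thesis by (simp add: sum.distrib)
qed

lemma sum_div_le: "(\<Sum>i\<in>I. a i div f) \<le> (\<Sum>i\<in>I. a i) div (f::nat)"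
proof (cases "f = 0")
  case False
  have "(\<Sum>i\<in>I. a i div f) * f \<le> (\<Sum>i\<in>I. a i)"
    unfolding sum_distrib_right by (intro sum_mono) simp
  then show ?thesis using False by (simp add: less_eq_div_iff_mult_less_eq)
qed simp

text \<open>Writing \<open>N = f - 1 + t\<close>, the quotient is at most \<open>t\<close>. Thus a
  slack of at least \<open>f - 1\<close> can lose a fraction \<open>1 / f\<close> of itself to waste
  and still be at least \<open>f - 1\<close>.\<close>

lemma pred_le_minus_div:
  fixes f N :: nat
  assumes "1 \<le> f" and "f - 1 \<le> N"
  shows "f - 1 \<le> N - N div f"
proof -
  obtain t where t: "N = f - 1 + t" using assms(2) by (metis le_Suc_ex)
  have "N div f \<le> t"
  proof (cases t)
    case 0
    then show ?thesis using assms(1) t by simp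
  next
    case (Suc s)
    have "N \<le> f * t + f - 1" using assms(1) unfolding t by (cases f) auto
    then have "N div f \<le> (f * t + f - 1) div f" by (rule div_le_mono)
    then show ?thesis using mult_add_pred_div[OF assms(1)] by simp
  qed
  then show ?thesis using t by simp
qed

text \<open>The fair share of a block with \<open>d\<close> hinges wastes at most \<open>(d - 1) div f\<close> hinges on joining a block to
  itself, which the slack absorbs. Fairness on the union of all blocks with at least two hinges makes
  the new vertex meet one of them, so that its block keeps a hinge.\<close>

lemma connectable_step:
  fixes x y :: "'a set \<Rightarrow> nat"
  defines "Y \<equiv> \<lambda>C. \<Sum>S\<in>Pow C - {{}}. y S"
  assumes finW: "finite W" and v: "v \<notin> W" and f: "1 \<le> f" and h: "2 \<le> f \<Longrightarrow> 2 \<le> h"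
    and supp: "\<And>S. x S > 0 \<Longrightarrow> S \<subseteq> W"
    and conn: "connectable h f W x P"
    and yx: "\<And>S. y S \<le> x S"
    and fairS: "\<And>S. fair f (x S * (h - card S)) (y S)"
    and fairC: "\<And>C. C \<in> P \<Longrightarrow> fair f (hinges h x C) (Y C)"
    and fairU: "fair f (h * x {} + (\<Sum>C\<in>{C\<in>P. 2 \<le> hinges h x C}. hinges h x C))
       (y {} + (\<Sum>C\<in>{C\<in>P. 2 \<le> hinges h x C}. Y C))"
  shows "\<exists>P'. connectable h (f - 1) (insert v W) (split_vertex v x y) P'"
proof -
  let ?x' = "split_vertex v x y"
  let ?d = "hinges h x"
  have part: "partition_on W P"
    and cover: "\<And>S. S \<noteq> {} \<Longrightarrow> x S > 0 \<Longrightarrow> \<exists>C\<in>P. S \<subseteq> C"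
    and linked: "\<And>C u w. C \<in> P \<Longrightarrow> u \<in> C \<Longrightarrow> w \<in> C \<Longrightarrow> (shares x)\<^sup>*\<^sup>* u w"
    and pos: "\<And>C. C \<in> P \<Longrightarrow> 1 \<le> ?d C"
    and slack: "f - 1 \<le> (\<Sum>C\<in>P. ?d C - 1) + (h - 1) * x {}"
    using conn f by (auto simp: connectable_def)
  have UP: "\<Union>P = W" and disjP: "disjoint P" using part by (auto simp: partition_on_def)
  have finP: "finite P" using finW UP finite_UnionD by metis
  have finC: "finite C" if "C \<in> P" for C using finW UP that by (meson Union_upper finite_subset)
  have CW: "C \<subseteq> W" if "C \<in> P" for C using UP that by auto
  \<comment> \<open>\<open>T\<close> consists of the blocks that the new vertex touches; they merge
    with it into the single block \<open>B\<close>, and all other blocks survive unchanged.\<close>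
  define T where "T = {C\<in>P. 0 < Y C}"
  define U where "U = \<Union>T"
  define B where "B = insert v U"
  define P' where "P' = insert B (P - T)"
  have TP: "T \<subseteq> P" by (auto simp: T_def)
  have vU: "v \<notin> U" using CW TP v by (auto simp: U_def)
  have finU: "finite U" unfolding U_def using TP finP finC by (auto intro: finite_subset)
  have yr: "y S \<le> x S * (h - card S)" for S using fair_le[OF f fairS] .
  have YC: "Y C - 1 \<le> (?d C - 1) div f" if "C \<in> P" for C
    using fair_pred[OF f fairC pos] that by simp
  have Yd: "Y C \<le> ?d C" for C unfolding Y_def hinges_def by (intro sum_mono yr)
  have y0: "y S = 0" if "C \<in> P - T" "S \<subseteq> C" "S \<noteq> {}" for C S
  proof -
    have "(\<Sum>S\<in>Pow C - {{}}. y S) = 0" using that by (auto simp: T_def Y_def)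
    then show ?thesis using that finC[of C] by auto
  qed
  have yT: "\<exists>C\<in>T. S \<subseteq> C" if "y S > 0" "S \<noteq> {}" for S
  proof -
    have "x S > 0" using that(1) yx[of S] by linarith
    from cover[OF that(2) this] obtain C where C: "C \<in> P" "S \<subseteq> C" by (rule bexE)
    then have "C \<in> T" using y0[of C S] that by auto
    then show ?thesis using C(2) by (rule bexI[rotated])
  qed
  have part': "partition_on (insert v W) P'"
  proof (rule partition_onI)
    show "\<Union>P' = insert v W" using UP TP by (auto simp: P'_def B_def U_def)
    show "{} \<notin> P'" using part by (auto simp: P'_def B_def partition_on_def)
    have BC: "disjnt B C" if "C \<in> P - T" for C
    proof -
      have "C' \<inter> C = {}" if "C' \<in> T" for C'
        using disjointD[OF disjP, of C' C] that \<open>C \<in> P - T\<close> TP by blast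
      moreover have "v \<notin> C" using CW \<open>C \<in> P - T\<close> v by auto
      ultimately show ?thesis by (auto simp: disjnt_def B_def U_def)
    qed
    show "disjnt p q" if "p \<in> P'" "q \<in> P'" "p \<noteq> q" for p q
      using that BC disjointD[OF disjP, of p q] by (auto simp: P'_def disjnt_sym) (auto simp: disjnt_def)
  qed
  have cover': "\<exists>C\<in>P'. S \<subseteq> C" if S: "S \<noteq> {}" "?x' S > 0" for S
  proof (cases "v \<in> S")
    case True
    then have ypos: "y (S - {v}) > 0" using S by (simp add: split_vertex_def)
    have "S - {v} \<subseteq> U"
    proof (cases "S - {v} = {}")
      case False
      then show ?thesis using yT[OF ypos] by (auto simp: U_def)
    qed auto
    then have "S \<subseteq> B" by (auto simp: B_def)
    then show ?thesis by (auto simp: P'_def)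
  next
    case False
    then have "x S > 0" using S by (simp add: split_vertex_def)
    from cover[OF S(1) this] obtain C where "C \<in> P" "S \<subseteq> C" by (rule bexE)
    then show ?thesis by (cases "C \<in> T") (auto simp: P'_def B_def U_def)
  qed
  have yins: "?x' (insert v S) = y S" if "S \<subseteq> W" for S
  proof -
    have "v \<notin> S" using v that by blast
    then show ?thesis by (simp add: split_vertex_def)
  qed
  \<comment> \<open>Old links persist: either some hyperedge keeps trace \<open>S\<close>, or all of
    them move to \<open>insert v S\<close>, which still contains the linked vertices.\<close>
  have sh: "shares x \<le> shares ?x'"
  proof (intro predicate2I)
    fix u w assume "shares x u w"
    then obtain S where S: "x S > 0" "u \<in> S" "w \<in> S" by (auto simp: shares_def)
    have "S \<subseteq> W" using supp S by blast
    show "shares ?x' u w"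
    proof (cases "y S < x S")
      case True
      then have "?x' S > 0" using \<open>S \<subseteq> W\<close> v by (auto simp: split_vertex_def)
      then show ?thesis using S by (auto simp: shares_def)
    next
      case False
      then have "?x' (insert v S) > 0" using yins[OF \<open>S \<subseteq> W\<close>] S by simp
      then show ?thesis using S unfolding shares_def by blast
    qed
  qed
  then have linked_old: "(shares ?x')\<^sup>*\<^sup>* u w" if "C \<in> P" "u \<in> C" "w \<in> C" for C u w
    using linked[OF that] rtranclp_mono by blast
  have symm: "symp (shares ?x')" by (auto simp: symp_def shares_def)
  have tov: "(shares ?x')\<^sup>*\<^sup>* u v" if uB: "u \<in> B" for u
  proof (cases "u = v")
    case False
    then obtain C where C: "C \<in> T" "u \<in> C" using uB by (auto simp: B_def U_def)
    then have "(\<Sum>S\<in>Pow C - {{}}. y S) \<noteq> 0" by (simp add: T_def Y_def)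
    then obtain S where "S \<in> Pow C - {{}}" "y S \<noteq> 0" by (rule sum.not_neutral_contains_not_neutral)
    then have S: "S \<subseteq> C" "S \<noteq> {}" "y S \<noteq> 0" by auto
    then obtain w where w: "w \<in> S" by blast
    have "S \<subseteq> W" using S C TP CW by blast
    then have "?x' (insert v S) > 0" using yins S by simp
    then have "shares ?x' w v" using w unfolding shares_def by blast
    moreover have "(shares ?x')\<^sup>*\<^sup>* u w" using C S w TP by (intro linked_old[of C]) auto
    ultimately show ?thesis by (rule rtranclp.rtrancl_into_rtrancl[rotated])
  qed simp
  have linked': "(shares ?x')\<^sup>*\<^sup>* u w" if "C \<in> P'" "u \<in> C" "w \<in> C" for C u w
  proof (cases "C = B")
    case True
    have "(shares ?x')\<^sup>*\<^sup>* v w"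
      using tov[of w] that True symm by (meson sympD symp_rtranclp)
    then show ?thesis using tov[of u] that True by simp
  next
    case False
    then show ?thesis using that linked_old by (auto simp: P'_def)
  qed
  have "if f - 1 = 0 then card P' \<le> 1
      else (\<forall>C\<in>P'. 1 \<le> hinges h ?x' C) \<and> f - 1 - 1 \<le> (\<Sum>C\<in>P'. hinges h ?x' C - 1) + (h - 1) * ?x' {}"
  proof (cases "f = 1")
    case True
    \<comment> \<open>With one vertex left every share is the whole block, and every block has a
      hinge, so all blocks merge into \<open>B\<close>.\<close>
    have all_taken: "P - T = {}"
    proof -
      have "Y C = ?d C" if "C \<in> P" for C using fair_dvd[of 1 "?d C" "Y C"] fairC[OF that] True by simp
      then show ?thesis using pos unfolding T_def by force
    qed
    show ?thesis using True by (simp only: P'_def all_taken) simp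
  next
    case False
    then have f2: "2 \<le> f" "2 \<le> h" using f h by auto
    have d_old: "hinges h ?x' C = ?d C" if "C \<in> P - T" for C
      unfolding hinges_def
    proof (rule sum.cong[OF refl])
      fix S assume "S \<in> Pow C - {{}}"
      then show "?x' S * (h - card S) = x S * (h - card S)"
        using y0[OF that] CW[of C] that v by (auto simp: split_vertex_def)
    qed
    \<comment> \<open>Every hinge given to \<open>v\<close> is lost to its block, whereas a
      hyperedge of empty trace that receives \<open>v\<close> brings its other \<open>h - 1\<close>
      hinges into \<open>B\<close>.\<close>
    have dB: "hinges h ?x' B = (\<Sum>C\<in>T. ?d C - Y C) + y {} * (h - 1)"
    proof -
      have merge: "?x' S * (h - card S) + ?x' (insert v S) * (h - card (insert v S)) = x S * (h - card S) - y S"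
        if "S \<subseteq> U" for S
      proof -
        have "U \<subseteq> W" using TP UP unfolding U_def by blast
        then have S: "v \<notin> S" "finite S" "S \<subseteq> W" using that vU finU by (auto intro: finite_subset)
        define r where "r = h - card S"
        have "h - card (insert v S) = r - 1" using S by (simp add: r_def)
        moreover have "(x S - y S) * r + y S * (r - 1) = x S * r - y S"
        proof (cases r)
          case 0
          then show ?thesis using yr[of S] by (simp add: r_def)
        next
          case (Suc s)
          obtain t where "x S = y S + t" using yx[of S] le_Suc_ex by blast
          then show ?thesis using Suc by (simp add: algebra_simps)
        qed
        ultimately show ?thesis using S yins[OF S(3)] by (simp add: split_vertex_def r_def)
      qed
      have "hinges h ?x' B = (\<Sum>S\<in>Pow U - {{}}. ?x' S * (h - card S) + ?x' (insert v S) * (h - card (insert v S)))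
          + ?x' {v} * (h - card {v})"
        unfolding hinges_def B_def by (rule sum_nonempty_subsets_insert[OF finU vU])
      also have "\<dots> = (\<Sum>S\<in>Pow U - {{}}. x S * (h - card S) - y S) + y {} * (h - 1)"
        using merge by (intro arg_cong2[where f="(+)"] sum.cong) (auto simp: split_vertex_def)
      also have "(\<Sum>S\<in>Pow U - {{}}. x S * (h - card S) - y S) = (\<Sum>C\<in>T. \<Sum>S\<in>Pow C - {{}}. x S * (h - card S) - y S)"
        unfolding U_def
      proof (rule sum_nonempty_subsets_blocks)
        show "finite (\<Union>T)" using finU by (simp add: U_def)
        show "disjoint T" using disjP TP pairwise_subset by blast
        fix S assume S: "S \<noteq> {}" "S \<subseteq> \<Union>T" "x S * (h - card S) - y S \<noteq> 0"
        then have "x S > 0" by (cases "x S") auto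
        from cover[OF S(1) this] obtain C where C: "C \<in> P" "S \<subseteq> C" by (rule bexE)
        obtain w where w: "w \<in> S" using S(1) by blast
        then obtain C' where C': "C' \<in> T" "w \<in> C'" using S(2) by blast
        then have "C' = C" using disjointD[OF disjP, of C' C] C w TP by blast
        then show "\<exists>C\<in>T. S \<subseteq> C" using C C' by blast
      qed
      also have "\<dots> = (\<Sum>C\<in>T. ?d C - Y C)"
        unfolding hinges_def Y_def using yr by (intro sum.cong refl sum_subtractf_nat) auto
      finally show ?thesis .
    qed
    \<comment> \<open>The big blocks and the empty-trace hyperedges together have at least
      \<open>f\<close> hinges, so \<open>v\<close> meets one of them. An empty-trace hyperedge still
      has \<open>h - 1 \<ge> 1\<close> hinges, and a block with \<open>d \<ge> 2\<close> hinges
      gives away at most \<open>(d - 1) div 2 + 1 < d\<close>.\<close>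
    have hB: "1 \<le> hinges h ?x' B"
    proof -
      let ?big = "{C\<in>P. 2 \<le> ?d C}"
      have "(\<Sum>C\<in>P. ?d C - 1) = (\<Sum>C\<in>?big. ?d C - 1)"
        using finP by (intro sum.mono_neutral_right) auto
      then have sl: "f - 1 \<le> (\<Sum>C\<in>?big. ?d C - 1) + (h - 1) * x {}" using slack by simp
      \<comment> \<open>The slack yields only \<open>f - 1\<close>. The missing unit comes from an
        empty-trace hyperedge, counted with \<open>h\<close> instead of \<open>h - 1\<close>, or
        else from a big block, counted with \<open>d\<close> instead of
        \<open>d - 1\<close>.\<close>
      have "f \<le> h * x {} + (\<Sum>C\<in>?big. ?d C)"
      proof (cases "x {} = 0")
        case True
        then have "(\<Sum>C\<in>?big. ?d C - 1) \<noteq> 0" using sl f2 by simp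
        then have "?big \<noteq> {}" by (metis sum.empty)
        then have "(\<Sum>C\<in>?big. ?d C - 1) < (\<Sum>C\<in>?big. ?d C)"
          using finP by (intro sum_strict_mono) auto
        then show ?thesis using sl True by simp
      next
        case False
        have "(\<Sum>C\<in>?big. ?d C - 1) \<le> (\<Sum>C\<in>?big. ?d C)" by (intro sum_mono) simp
        moreover have "(h - 1) * x {} + 1 \<le> h * x {}" using False f2 by (cases h) auto
        ultimately show ?thesis using sl by linarith
      qed
      then have "1 \<le> y {} + (\<Sum>C\<in>?big. Y C)" using fair_pos[OF f fairU] by simp
      then consider "y {} \<ge> 1" | "(\<Sum>C\<in>?big. Y C) \<noteq> 0" by linarith
      then show ?thesis
      proof cases
        case 1
        then have "1 * 1 \<le> y {} * (h - 1)" using f2 by (intro mult_le_mono) auto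
        then show ?thesis unfolding dB by linarith
      next
        case 2
        then obtain C where "C \<in> ?big" "Y C \<noteq> 0" by (rule sum.not_neutral_contains_not_neutral)
        then have C: "C \<in> P" "2 \<le> ?d C" "Y C \<noteq> 0" by auto
        have "Y C \<le> (?d C - 1) div f + 1" using YC[OF C(1)] by simp
        also have "(?d C - 1) div f \<le> (?d C - 1) div 2" using f2 by (intro div_le_mono2) auto
        also have "(?d C - 1) div 2 < ?d C - 1" using C by simp
        finally have "1 \<le> ?d C - Y C" using C(2) by linarith
        also have "\<dots> \<le> (\<Sum>C\<in>T. ?d C - Y C)"
          using C finP TP by (intro member_le_sum) (auto simp: T_def)
        finally show ?thesis by (simp add: dB)
      qed
    qed
    have BP: "B \<notin> P" using v CW by (auto simp: B_def)
    let ?K = "\<Sum>C\<in>P. ?d C - 1"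
    \<comment> \<open>Waste arises only inside blocks, so after bounding it by
      \<open>?K div f\<close> the term \<open>(h - 1) * x {}\<close> is kept in full.\<close>
    have "f - 1 \<le> (?K + (h - 1) * x {}) - (?K + (h - 1) * x {}) div f"
      using slack by (intro pred_le_minus_div f)
    moreover have "?K div f \<le> (?K + (h - 1) * x {}) div f" by (intro div_le_mono) simp
    moreover have "(\<Sum>C\<in>P. (?d C - 1) - (?d C - 1) div f) \<ge> ?K - ?K div f"
    proof -
      have "(\<Sum>C\<in>P. (?d C - 1) - (?d C - 1) div f) = ?K - (\<Sum>C\<in>P. (?d C - 1) div f)"
        by (intro sum_subtractf_nat) simp
      then show ?thesis using sum_div_le[of "\<lambda>C. ?d C - 1" f P] by simp
    qed
    moreover have "?K div f \<le> ?K" by simp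
    ultimately have "f - 1 \<le> (\<Sum>C\<in>P. (?d C - 1) - (?d C - 1) div f) + (h - 1) * x {}"
      by linarith
    also have "(\<Sum>C\<in>P. (?d C - 1) - (?d C - 1) div f)
        = (\<Sum>C\<in>P - T. (?d C - 1) - (?d C - 1) div f) + (\<Sum>C\<in>T. (?d C - 1) - (?d C - 1) div f)"
      using TP finP by (rule sum.subset_diff)
    finally have main: "f - 1 \<le> (\<Sum>C\<in>P - T. (?d C - 1) - (?d C - 1) div f)
        + (\<Sum>C\<in>T. (?d C - 1) - (?d C - 1) div f) + (h - 1) * x {}" .
    have old_part: "(\<Sum>C\<in>P - T. (?d C - 1) - (?d C - 1) div f) \<le> (\<Sum>C\<in>P - T. hinges h ?x' C - 1)"
      using d_old by (intro sum_mono) simp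
    have "(\<Sum>C\<in>T. (?d C - 1) - (?d C - 1) div f) \<le> (\<Sum>C\<in>T. ?d C - Y C)"
    proof (rule sum_mono)
      fix C assume "C \<in> T"
      then have "C \<in> P" "Y C > 0" by (auto simp: T_def)
      then show "(?d C - 1) - (?d C - 1) div f \<le> ?d C - Y C" using YC[of C] by linarith
    qed
    then have "f - 1 \<le> (\<Sum>C\<in>P - T. hinges h ?x' C - 1) + (\<Sum>C\<in>T. ?d C - Y C) + (h - 1) * x {}"
      using main old_part by linarith
    moreover have "(h - 1) * x {} = (h - 1) * ?x' {} + y {} * (h - 1)"
    proof -
      obtain t where "x {} = y {} + t" using yx[of "{}"] le_Suc_ex by blast
      then show ?thesis by (simp add: split_vertex_def algebra_simps)
    qed
    moreover have "(\<Sum>C\<in>P'. hinges h ?x' C - 1) = (hinges h ?x' B - 1) + (\<Sum>C\<in>P - T. hinges h ?x' C - 1)"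
      unfolding P'_def using finP BP by simp
    \<comment> \<open>The merged block is charged one unit, the \<open>- 1\<close> in its own term;
      this matches the drop of the target from \<open>f - 1\<close> to
      \<open>f - 1 - 1\<close>.\<close>
    ultimately have "f - 1 - 1 \<le> (\<Sum>C\<in>P'. hinges h ?x' C - 1) + (h - 1) * ?x' {}"
      using hB dB by linarith
    moreover have "\<forall>C\<in>P'. 1 \<le> hinges h ?x' C" using hB d_old pos by (auto simp: P'_def)
    ultimately show ?thesis using f2 by simp
  qed
  then have "connectable h (f - 1) (insert v W) ?x' P'"
    unfolding connectable_def using part' cover' linked' by blast
  then show ?thesis by blast
qed

section \<open>Splitting off one vertex\<close>

text \<open>For disjoint \<open>P\<close> the union has at most one nonempty member. Since
  \<open>{}\<close> is never a block of a partition, it serves as the label of the empty trace and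
  of all sets inside no block.\<close>

definition block_of :: "'a set set \<Rightarrow> 'a set \<Rightarrow> 'a set" where
  "block_of P S = \<Union>{C\<in>P. S \<noteq> {} \<and> S \<subseteq> C}"

lemma block_of_eq:
  assumes "disjoint P" and "C \<in> P" and "S \<noteq> {}" and "S \<subseteq> C"
  shows "block_of P S = C"
proof -
  have "{C'\<in>P. S \<noteq> {} \<and> S \<subseteq> C'} = {C}"
  proof (intro equalityI subsetI)
    fix C' assume C': "C' \<in> {C'\<in>P. S \<noteq> {} \<and> S \<subseteq> C'}"
    then have "C' \<inter> C \<noteq> {}" using assms by auto
    then show "C' \<in> {C}" using disjointD[OF assms(1), of C' C] assms(2) C' by auto
  qed (use assms in auto)
  then show ?thesis by (simp add: block_of_def)
qed

lemma block_of_mem: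
  assumes "disjoint P" and "block_of P S \<noteq> {}"
  shows "block_of P S \<in> P \<and> S \<noteq> {} \<and> S \<subseteq> block_of P S"
proof -
  obtain C where "C \<in> P" "S \<noteq> {}" "S \<subseteq> C" using assms(2) by (auto simp: block_of_def)
  then show ?thesis using block_of_eq[OF assms(1)] by metis
qed

lemma block_of_fibre:
  assumes "partition_on W P" and "C \<in> P"
  shows "{S\<in>Pow W. block_of P S = C} = Pow C - {{}}"
proof -
  have disj: "disjoint P" and C: "C \<noteq> {}" "C \<subseteq> W" using assms by (auto simp: partition_on_def)
  show ?thesis
  proof (intro equalityI subsetI)
    fix S assume "S \<in> {S\<in>Pow W. block_of P S = C}"
    then show "S \<in> Pow C - {{}}" using block_of_mem[OF disj, of S] C by auto
  next
    fix S assume "S \<in> Pow C - {{}}"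
    then show "S \<in> {S\<in>Pow W. block_of P S = C}" using block_of_eq[OF disj assms(2), of S] C by auto
  qed
qed

text \<open>The label \<open>{}\<close> also collects the nonempty sets that fit in no block, but
  \<open>g\<close> vanishes on them, so only \<open>g {}\<close> remains.\<close>

lemma sum_union_of_blocks:
  fixes g :: "'a set \<Rightarrow> nat"
  assumes "finite W" and P: "partition_on W P" and "Q \<subseteq> P"
    and g: "\<And>S. S \<noteq> {} \<Longrightarrow> g S \<noteq> 0 \<Longrightarrow> \<exists>C\<in>P. S \<subseteq> C"
  shows "(\<Sum>S\<in>{S\<in>Pow W. block_of P S = {} \<or> block_of P S \<in> Q}. g S)
    = g {} + (\<Sum>C\<in>Q. \<Sum>S\<in>Pow C - {{}}. g S)"
proof -
  let ?G = "{S\<in>Pow W. block_of P S = {} \<or> block_of P S \<in> Q}"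
  have disj: "disjoint P" and nonempty: "{} \<notin> P" and UP: "\<Union>P = W"
    using P by (auto simp: partition_on_def)
  have "finite P" using assms(1) UP finite_UnionD by metis
  then have finQ: "finite Q" using assms(3) finite_subset by blast
  have "(\<Sum>S\<in>?G. g S) = (\<Sum>C\<in>insert {} Q. \<Sum>S\<in>{S\<in>?G. block_of P S = C}. g S)"
    using assms(1) finQ by (intro sum.group[symmetric]) auto
  also have "\<dots> = (\<Sum>S\<in>{S\<in>?G. block_of P S = {}}. g S) + (\<Sum>C\<in>Q. \<Sum>S\<in>{S\<in>?G. block_of P S = C}. g S)"
    using finQ nonempty assms(3) by (intro sum.insert) auto
  also have "(\<Sum>C\<in>Q. \<Sum>S\<in>{S\<in>?G. block_of P S = C}. g S) = (\<Sum>C\<in>Q. \<Sum>S\<in>Pow C - {{}}. g S)"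
  proof (rule sum.cong[OF refl])
    fix C assume C: "C \<in> Q"
    then have "{S\<in>?G. block_of P S = C} = {S\<in>Pow W. block_of P S = C}" by auto
    then show "(\<Sum>S\<in>{S\<in>?G. block_of P S = C}. g S) = (\<Sum>S\<in>Pow C - {{}}. g S)"
      using block_of_fibre[OF P, of C] C assms(3) by auto
  qed
  also have "(\<Sum>S\<in>{S\<in>?G. block_of P S = {}}. g S) = (\<Sum>S\<in>{{}}. g S)"
  proof (rule sum.mono_neutral_right)
    show "{{}} \<subseteq> {S\<in>?G. block_of P S = {}}" by (auto simp: block_of_def)
    show "\<forall>S\<in>{S\<in>?G. block_of P S = {}} - {{}}. g S = 0"
    proof
      fix S assume S: "S \<in> {S\<in>?G. block_of P S = {}} - {{}}"
      show "g S = 0"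
      proof (rule ccontr)
        assume "g S \<noteq> 0"
        then obtain C where C: "C \<in> P" "S \<subseteq> C" using g[of S] S by auto
        then have "block_of P S = C" using block_of_eq[OF disj, of C S] S by auto
        then show False using S C nonempty by auto
      qed
    qed
  qed (use assms(1) in auto)
  finally show ?thesis by simp
qed

section \<open>The invariant of a single class and of all classes together\<close>

lemma sum_Pow_insert:
  assumes "finite W" and "v \<notin> W"
  shows "(\<Sum>S\<in>Pow (insert v W). g S) = (\<Sum>S\<in>Pow W. g S + g (insert v S))"
proof -
  have "Pow W \<inter> insert v ` Pow W = {}" using assms(2) by auto
  then have "(\<Sum>S\<in>Pow (insert v W). g S) = (\<Sum>S\<in>Pow W. g S) + (\<Sum>S\<in>insert v ` Pow W. g S)"
    using assms(1) by (simp add: Pow_insert sum.union_disjoint)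
  also have "inj_on (insert v) (Pow W)" using assms(2) by (auto simp: inj_on_def insert_ident)
  then have "(\<Sum>S\<in>insert v ` Pow W. g S) = (\<Sum>S\<in>Pow W. g (insert v S))"
    by (simp add: sum.reindex)
  finally show ?thesis by (simp add: sum.distrib)
qed

text \<open>The two bounds on the hinge total say that the average degree still owed to the
  amalgamated vertices lies between floor and ceiling of \<open>h * m / n\<close>. They are fixed
  from the start, so that the degree of each later vertex falls in the same range.\<close>

definition class_state :: "nat \<Rightarrow> nat \<Rightarrow> nat \<Rightarrow> 'a set \<Rightarrow> ('a set \<Rightarrow> nat) \<Rightarrow> bool" where
  "class_state n h m W x \<longleftrightarrow>
     (\<forall>S. x S > 0 \<longrightarrow> S \<subseteq> W \<and> card S \<le> h) \<and>
     (\<Sum>S\<in>Pow W. x S) = m \<and>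
     (\<forall>u\<in>W. fair n (h * m) (\<Sum>S\<in>Pow W. if u \<in> S then x S else 0)) \<and>
     (n - card W) * (h * m div n) \<le> (\<Sum>S\<in>Pow W. x S * (h - card S)) \<and>
     (\<Sum>S\<in>Pow W. x S * (h - card S)) \<le> (n - card W) * ((h * m + n - 1) div n) \<and>
     (n - 1 \<le> (h - 1) * m \<longrightarrow> (\<exists>P. connectable h (n - card W) W x P))"

text \<open>Only the choice of \<open>y\<close> couples the classes; once it is fair, each class
  advances separately.\<close>

lemma class_state_step:
  assumes finW: "finite W" and v: "v \<notin> W" and n: "card W < n"
    and st: "class_state n h m W x"
    and yx: "\<And>S. y S \<le> x S"
    and fairS: "\<And>S. fair (n - card W) (x S * (h - card S)) (y S)"
    and fairW: "fair (n - card W) (\<Sum>S\<in>Pow W. x S * (h - card S)) (\<Sum>S\<in>Pow W. y S)"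
    and conn: "n - 1 \<le> (h - 1) * m \<Longrightarrow> \<exists>P'. connectable h (n - card W - 1) (insert v W) (split_vertex v x y) P'"
  shows "class_state n h m (insert v W) (split_vertex v x y)"
proof -
  let ?x' = "split_vertex v x y"
  define f where "f = n - card W"
  have f: "1 \<le> f" using n by (simp add: f_def)
  have f': "n - card (insert v W) = f - 1" using finW v by (simp add: f_def)
  have supp: "S \<subseteq> W \<and> card S \<le> h" if "x S > 0" for S using st that by (auto simp: class_state_def)
  have yr: "y S \<le> x S * (h - card S)" for S using fair_le[OF f] fairS by (simp add: f_def)
  have old: "?x' S = x S - y S" if "S \<subseteq> W" for S using v that by (auto simp: split_vertex_def)
  have new: "?x' (insert v S) = y S" if "S \<subseteq> W" for S
  proof -
    have "v \<notin> S" using v that by blast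
    then show ?thesis by (simp add: split_vertex_def)
  qed
  have card_ins: "card (insert v S) = Suc (card S)" if "S \<subseteq> W" for S
    using finW v that by (meson card_insert_disjoint finite_subset subsetD)
  note fs = fair_step[OF f fairW[folded f_def], of "h * m div n" "(h * m + n - 1) div n"]
  have "f * (h * m div n) \<le> (\<Sum>S\<in>Pow W. x S * (h - card S))"
    "(\<Sum>S\<in>Pow W. x S * (h - card S)) \<le> f * ((h * m + n - 1) div n)"
    using st by (auto simp: class_state_def f_def)
  note fs = fs[OF this]
  have d': "(\<Sum>S\<in>Pow (insert v W). ?x' S * (h - card S)) = (\<Sum>S\<in>Pow W. x S * (h - card S)) - (\<Sum>S\<in>Pow W. y S)"
  proof -
    have "(\<Sum>S\<in>Pow (insert v W). ?x' S * (h - card S))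
        = (\<Sum>S\<in>Pow W. ?x' S * (h - card S) + ?x' (insert v S) * (h - card (insert v S)))"
      by (rule sum_Pow_insert[OF finW v])
    also have "\<dots> = (\<Sum>S\<in>Pow W. x S * (h - card S) - y S)"
    proof (rule sum.cong[OF refl])
      fix S assume "S \<in> Pow W"
      then have S: "S \<subseteq> W" by simp
      define r where "r = h - card S"
      have "(x S - y S) * r + y S * (r - 1) = x S * r - y S"
      proof (cases r)
        case 0
        then show ?thesis using yr[of S] by (simp add: r_def)
      next
        case (Suc s)
        obtain t where "x S = y S + t" using yx[of S] le_Suc_ex by blast
        then show ?thesis using Suc by (simp add: algebra_simps)
      qed
      then show "?x' S * (h - card S) + ?x' (insert v S) * (h - card (insert v S)) = x S * (h - card S) - y S"
        using old[OF S] new[OF S] card_ins[OF S] by (simp add: r_def)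
    qed
    also have "\<dots> = (\<Sum>S\<in>Pow W. x S * (h - card S)) - (\<Sum>S\<in>Pow W. y S)"
      by (intro sum_subtractf_nat yr)
    finally show ?thesis .
  qed
  have size': "(\<Sum>S\<in>Pow (insert v W). ?x' S) = m"
  proof -
    have "(\<Sum>S\<in>Pow (insert v W). ?x' S) = (\<Sum>S\<in>Pow W. x S)"
      unfolding sum_Pow_insert[OF finW v] using old new yx by (intro sum.cong) auto
    then show ?thesis using st by (simp add: class_state_def)
  qed
  have supp': "S \<subseteq> insert v W \<and> card S \<le> h" if S: "?x' S > 0" for S
  proof (cases "v \<in> S")
    case True
    then have y: "y (S - {v}) > 0" using S by (simp add: split_vertex_def)
    then have "x (S - {v}) > 0" using yx[of "S - {v}"] by linarith
    then have sub: "S - {v} \<subseteq> W" using supp by blast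
    \<comment> \<open>A positive share needs a hinge, so the old trace has fewer than
      \<open>h\<close> elements and there is room for \<open>v\<close>.\<close>
    have "x (S - {v}) * (h - card (S - {v})) > 0" using yr[of "S - {v}"] y by linarith
    then have "card (S - {v}) < h" by simp
    moreover have "card S = Suc (card (S - {v}))" using card_ins[OF sub] True by (simp add: insert_absorb)
    ultimately show ?thesis using sub by auto
  next
    case False
    then show ?thesis using supp[of S] S by (auto simp: split_vertex_def)
  qed
  have deg': "fair n (h * m) (\<Sum>S\<in>Pow (insert v W). if u \<in> S then ?x' S else 0)" if u: "u \<in> insert v W" for u
  proof (cases "u = v")
    case True
    have "(\<Sum>S\<in>Pow (insert v W). if u \<in> S then ?x' S else 0) = (\<Sum>S\<in>Pow W. y S)"
      unfolding sum_Pow_insert[OF finW v] using new v True by (intro sum.cong) auto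
    then show ?thesis using fs(1,2) by (simp add: fair_def)
  next
    case False
    have "(\<Sum>S\<in>Pow (insert v W). if u \<in> S then ?x' S else 0) = (\<Sum>S\<in>Pow W. if u \<in> S then x S else 0)"
      unfolding sum_Pow_insert[OF finW v] using old new yx False by (intro sum.cong) auto
    then show ?thesis using st u False by (auto simp: class_state_def)
  qed
  show ?thesis
    unfolding class_state_def f'
    using supp' size' deg' fs(3,4) d' conn by (auto simp: f_def)
qed

text \<open>The count is restricted to \<open>card S \<le> h\<close> because truncated subtraction
  would turn the binomial coefficient into 1 for larger traces, which never occur.\<close>

definition split_state :: "nat \<Rightarrow> nat \<Rightarrow> nat \<Rightarrow> nat \<Rightarrow> (nat \<Rightarrow> nat) \<Rightarrow> 'a set \<Rightarrow> (nat \<Rightarrow> 'a set \<Rightarrow> nat) \<Rightarrow> bool" where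
  "split_state lam n h k a W x \<longleftrightarrow>
     (\<forall>S. S \<subseteq> W \<longrightarrow> card S \<le> h \<longrightarrow> (\<Sum>j\<in>{1..k}. x j S) = lam * ((n - card W) choose (h - card S))) \<and>
     (\<forall>j\<in>{1..k}. class_state n h (a j) W (x j))"

lemma split_state_step:
  assumes finW: "finite W" and v: "v \<notin> W" and n: "card W < n" and st: "split_state lam n h k a W x"
  shows "\<exists>x'. split_state lam n h k a (insert v W) x'"
proof -
  define f where "f = n - card W"
  have f: "1 \<le> f" using n by (simp add: f_def)
  have tot: "(\<Sum>j\<in>{1..k}. x j S) = lam * (f choose (h - card S))" if "S \<subseteq> W" "card S \<le> h" for S
    using st that by (auto simp: split_state_def f_def)
  have cls: "class_state n h (a j) W (x j)" if "j \<in> {1..k}" for j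
    using st that by (simp add: split_state_def)
  have supp: "S \<subseteq> W \<and> card S \<le> h" if "x j S > 0" "j \<in> {1..k}" for j S
    using cls[OF that(2)] that(1) by (simp add: class_state_def)
  have "\<forall>j. \<exists>P. j \<in> {1..k} \<longrightarrow> n - 1 \<le> (h - 1) * a j \<longrightarrow> connectable h f W (x j) P"
    using cls by (auto simp: class_state_def f_def)
  then obtain P where P: "\<And>j. j \<in> {1..k} \<Longrightarrow> n - 1 \<le> (h - 1) * a j \<Longrightarrow> connectable h f W (x j) (P j)"
    by metis
  define E where "E = {1..k} \<times> Pow W"
  have finE: "finite E" using finW by (simp add: E_def)
  define N where "N = (\<lambda>(j, S). x j S * (h - card S))"
  \<comment> \<open>Within class \<open>j\<close> the chain goes from traces to blocks
    (\<open>q\<close>), to two groups of blocks (\<open>r\<close>), to the whole class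
    (\<open>fst\<close>). The flag \<open>True\<close> gathers the label \<open>{}\<close>, hence
    the empty trace, with the blocks of at least two hinges.\<close>
  define q where "q = (\<lambda>(j, S). (j, block_of (P j) S))"
  define r where "r = (\<lambda>(j, C). (j, C = {} \<or> 2 \<le> hinges h (x j) C))"
  from fair_rounding[OF finE f, of N snd q r fst] obtain z where
    z: "\<And>e. e \<in> E \<Longrightarrow> fair f (N e) (z e)"
      "\<And>S. fair f (\<Sum>e\<in>{e\<in>E. snd e = S}. N e) (\<Sum>e\<in>{e\<in>E. snd e = S}. z e)"
      "\<And>c. fair f (\<Sum>e\<in>{e\<in>E. q e = c}. N e) (\<Sum>e\<in>{e\<in>E. q e = c}. z e)"
      "\<And>c. fair f (\<Sum>e\<in>{e\<in>E. r (q e) = c}. N e) (\<Sum>e\<in>{e\<in>E. r (q e) = c}. z e)"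
      "\<And>c. fair f (\<Sum>e\<in>{e\<in>E. fst (r (q e)) = c}. N e) (\<Sum>e\<in>{e\<in>E. fst (r (q e)) = c}. z e)"
    by blast
  define y where "y j S = (if (j, S) \<in> E then z (j, S) else 0)" for j S
  have fairS: "fair f (x j S * (h - card S)) (y j S)" if j: "j \<in> {1..k}" for j S
  proof (cases "S \<subseteq> W")
    case True
    then show ?thesis using z(1)[of "(j, S)"] j by (simp add: E_def N_def y_def)
  next
    case False
    then have "x j S = 0" using supp[of j S] j by auto
    then show ?thesis using False fair_0[OF f] by (simp add: y_def E_def)
  qed
  have yx: "y j S \<le> x j S" if j: "j \<in> {1..k}" for j S
  proof (cases "x j S = 0")
    case True
    then show ?thesis using fairS[OF j, of S] fair_0[OF f] by simp
  next
    case False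
    then have S: "S \<subseteq> W" "card S \<le> h" using supp[of j S] j by auto
    have "(\<Sum>j\<in>{1..k}. x j S) \<noteq> 0" using False j by auto
    \<comment> \<open>A trace that occurs has a nonzero count over all classes, so its hyperedges
      have at most \<open>f\<close> hinges each.\<close>
    then have "f choose (h - card S) \<noteq> 0" unfolding tot[OF S] by (metis mult_0_right)
    then have "h - card S \<le> f" using binomial_eq_0[of f "h - card S"] by linarith
    then show ?thesis using fair_le_mult[OF f fairS[OF j]] by blast
  qed
  have sub_E: "(\<Sum>e\<in>{e\<in>E. fst e = j \<and> R (snd e)}. w e) = (\<Sum>S\<in>{S\<in>Pow W. R S}. w (j, S))"
    if "j \<in> {1..k}" for j R and w :: "nat \<times> 'a set \<Rightarrow> nat"
  proof -
    have "{e\<in>E. fst e = j \<and> R (snd e)} = Pair j ` {S\<in>Pow W. R S}" using that by (auto simp: E_def)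
    then show ?thesis by (simp add: sum.reindex inj_on_def)
  qed
  have fair_class: "fair f (\<Sum>S\<in>{S\<in>Pow W. R S}. x j S * (h - card S)) (\<Sum>S\<in>{S\<in>Pow W. R S}. y j S)"
    if j: "j \<in> {1..k}" and "fair f (\<Sum>e\<in>{e\<in>E. fst e = j \<and> R (snd e)}. N e) (\<Sum>e\<in>{e\<in>E. fst e = j \<and> R (snd e)}. z e)"
    for j R
  proof -
    have "(\<Sum>S\<in>{S\<in>Pow W. R S}. y j S) = (\<Sum>S\<in>{S\<in>Pow W. R S}. z (j, S))"
      using j by (intro sum.cong) (auto simp: y_def E_def)
    then show ?thesis using that(2) unfolding sub_E[OF j] by (simp add: N_def)
  qed
  have fairW: "fair f (\<Sum>S\<in>Pow W. x j S * (h - card S)) (\<Sum>S\<in>Pow W. y j S)" if j: "j \<in> {1..k}" for j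
  proof -
    have "{e\<in>E. fst (r (q e)) = j} = {e\<in>E. fst e = j \<and> True}" by (auto simp: r_def q_def)
    then show ?thesis using fair_class[OF j, of "\<lambda>_. True"] z(5)[of j] by (simp add: Pow_def)
  qed
  have ysum: "(\<Sum>j\<in>{1..k}. y j S) = (if card S < h then lam * ((f - 1) choose (h - card S - 1)) else 0)"
    if S: "S \<subseteq> W" "card S \<le> h" for S
  proof (cases "card S < h")
    case True
    then obtain s where s: "h - card S = Suc s" by (metis Suc_diff_Suc)
    have "{e\<in>E. snd e = S} = (\<lambda>j. (j, S)) ` {1..k}" using S by (auto simp: E_def)
    then have col: "(\<Sum>e\<in>{e\<in>E. snd e = S}. w e) = (\<Sum>j\<in>{1..k}. w (j, S))" for w :: "nat \<times> 'a set \<Rightarrow> nat"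
      by (simp add: sum.reindex inj_on_def)
    have "(\<Sum>j\<in>{1..k}. N (j, S)) = (\<Sum>j\<in>{1..k}. x j S) * Suc s"
      by (simp only: N_def s sum_distrib_right prod.case)
    \<comment> \<open>Binomial absorption makes the hinge total of trace \<open>S\<close> divisible
      by \<open>f\<close>, so its fair share is exact.\<close>
    also have "\<dots> = lam * (Suc s * (f choose Suc s))" using tot[OF S] s by (simp only: mult_ac)
    also have "\<dots> = f * (lam * ((f - 1) choose s))" by (simp only: binomial_absorption mult_ac)
    finally have "(\<Sum>j\<in>{1..k}. z (j, S)) = lam * ((f - 1) choose s)"
      using z(2)[of S] unfolding col using fair_dvd[OF f] by simp
    moreover have "(\<Sum>j\<in>{1..k}. y j S) = (\<Sum>j\<in>{1..k}. z (j, S))"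
      using S by (intro sum.cong) (auto simp: y_def E_def)
    ultimately show ?thesis using True s by simp
  next
    case False
    then have "y j S = 0" if "j \<in> {1..k}" for j using fairS[OF that, of S] fair_0[OF f] by simp
    then show ?thesis using False by simp
  qed
  let ?x' = "\<lambda>j. split_vertex v (x j) (y j)"
  have "class_state n h (a j) (insert v W) (?x' j)" if j: "j \<in> {1..k}" for j
  proof (rule class_state_step[OF finW v n cls[OF j] yx[OF j] fairS[OF j, unfolded f_def] fairW[OF j, unfolded f_def]])
    assume big: "n - 1 \<le> (h - 1) * a j"
    note cP = P[OF j big]
    have part: "partition_on W (P j)"
      and cover: "\<And>S. S \<noteq> {} \<Longrightarrow> x j S > 0 \<Longrightarrow> \<exists>C\<in>P j. S \<subseteq> C"
      using cP by (auto simp: connectable_def)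
    have disj: "disjoint (P j)" using part by (simp add: partition_on_def)
    let ?big = "{C\<in>P j. 2 \<le> hinges h (x j) C}"
    have fairC: "fair f (hinges h (x j) C) (\<Sum>S\<in>Pow C - {{}}. y j S)" if C: "C \<in> P j" for C
    proof -
      have "{e\<in>E. q e = (j, C)} = {e\<in>E. fst e = j \<and> block_of (P j) (snd e) = C}" by (auto simp: q_def)
      then show ?thesis
        using fair_class[OF j, of "\<lambda>S. block_of (P j) S = C"] z(3)[of "(j, C)"] block_of_fibre[OF part C]
        by (simp add: hinges_def)
    qed
    have fairU: "fair f (h * x j {} + (\<Sum>C\<in>?big. hinges h (x j) C)) (y j {} + (\<Sum>C\<in>?big. \<Sum>S\<in>Pow C - {{}}. y j S))"
    proof -
      let ?R = "\<lambda>S. block_of (P j) S = {} \<or> block_of (P j) S \<in> ?big"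
      have R: "block_of (P j) S = {} \<or> 2 \<le> hinges h (x j) (block_of (P j) S) \<longleftrightarrow> ?R S" for S
        using block_of_mem[OF disj, of S] by auto
      have "r (q e) = (j, True) \<longleftrightarrow> fst e = j \<and> ?R (snd e)" for e
        unfolding R[symmetric] by (cases e) (auto simp: r_def q_def)
      then have "{e\<in>E. r (q e) = (j, True)} = {e\<in>E. fst e = j \<and> ?R (snd e)}" by simp
      then have "fair f (\<Sum>S\<in>{S\<in>Pow W. ?R S}. x j S * (h - card S)) (\<Sum>S\<in>{S\<in>Pow W. ?R S}. y j S)"
        using fair_class[OF j, of ?R] z(4)[of "(j, True)"] by simp
      moreover have "(\<Sum>S\<in>{S\<in>Pow W. ?R S}. y j S) = y j {} + (\<Sum>C\<in>?big. \<Sum>S\<in>Pow C - {{}}. y j S)"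
      proof (rule sum_union_of_blocks[OF finW part])
        show "\<exists>C\<in>P j. S \<subseteq> C" if "S \<noteq> {}" "y j S \<noteq> 0" for S
          using cover[OF that(1)] that(2) yx[OF j, of S] by linarith
      qed auto
      moreover have "(\<Sum>S\<in>{S\<in>Pow W. ?R S}. x j S * (h - card S))
          = x j {} * (h - card ({} :: 'a set)) + (\<Sum>C\<in>?big. \<Sum>S\<in>Pow C - {{}}. x j S * (h - card S))"
        using cover by (intro sum_union_of_blocks[OF finW part, where g="\<lambda>S. x j S * (h - card S)"]) auto
      ultimately show ?thesis by (simp add: hinges_def mult.commute)
    qed
    \<comment> \<open>Since \<open>f \<le> n\<close>, the threshold is positive, which is impossible
      for \<open>h = 1\<close>.\<close>
    have h2: "2 \<le> h" if "2 \<le> f"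
    proof -
      have "2 \<le> n" using that by (simp add: f_def)
      then have "(h - 1) * a j \<noteq> 0" using big by linarith
      then show ?thesis by simp
    qed
    show "\<exists>P'. connectable h (n - card W - 1) (insert v W) (?x' j) P'"
      using connectable_step[OF finW v f h2 _ cP yx[OF j] fairS[OF j] fairC fairU] supp j
      unfolding f_def by blast
  qed
  moreover have "(\<Sum>j\<in>{1..k}. ?x' j S) = lam * ((n - card (insert v W)) choose (h - card S))"
    if S: "S \<subseteq> insert v W" "card S \<le> h" for S
  proof -
    have f': "n - card (insert v W) = f - 1" using finW v by (simp add: f_def)
    show ?thesis
    proof (cases "v \<in> S")
      case True
      have S0: "S - {v} \<subseteq> W" using S by auto
      have "finite S" using S finW by (meson finite_insert finite_subset)
      then have "card S = Suc (card (S - {v}))" using True by (metis card_Suc_Diff1)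
      then have "(\<Sum>j\<in>{1..k}. y j (S - {v})) = lam * ((f - 1) choose (h - card S))"
        using ysum[OF S0] S by simp
      then show ?thesis using True f' by (simp add: split_vertex_def)
    next
      case False
      then have SW: "S \<subseteq> W" using S by auto
      have "(\<Sum>j\<in>{1..k}. ?x' j S) = (\<Sum>j\<in>{1..k}. x j S - y j S)" using False by (simp add: split_vertex_def)
      also have "\<dots> = (\<Sum>j\<in>{1..k}. x j S) - (\<Sum>j\<in>{1..k}. y j S)"
        using yx by (intro sum_subtractf_nat) auto
      \<comment> \<open>Pascal's rule: removing the hyperedges that take \<open>v\<close> leaves
        those that avoid it. For \<open>card S = h\<close> nothing is removed and both coefficients
        are 1.\<close>
      also have "\<dots> = lam * ((f - 1) choose (h - card S))"
      proof (cases "card S < h")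
        case True
        then have "f choose (h - card S) = ((f - 1) choose (h - card S - 1)) + ((f - 1) choose (h - card S))"
          using f by (intro choose_reduce_nat) auto
        then show ?thesis using True tot[OF SW S(2)] ysum[OF SW S(2)] by (simp add: distrib_left)
      next
        case False
        then show ?thesis using S(2) tot[OF SW S(2)] ysum[OF SW S(2)] by simp
      qed
      finally show ?thesis using f' by simp
    qed
  qed
  ultimately have "split_state lam n h k a (insert v W) ?x'" by (simp add: split_state_def)
  then show ?thesis by blast
qed

text \<open>All hyperedges have empty trace and the partition is empty, so the slack inequality is
  literally \<open>n - 1 \<le> (h - 1) * a j\<close>.\<close>

lemma split_state_empty:
  assumes "n \<ge> 1" and "h \<ge> 1" and "(\<Sum>j\<in>{1..k}. a j) = lam * (n choose h)"
  shows "split_state lam n h k a {} (\<lambda>j S. if S = {} then a j else 0)"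
proof -
  have "n * (h * a j div n) \<le> h * a j" for j by simp
  moreover have "h * a j \<le> n * ((h * a j + n - 1) div n)" for j
  proof -
    have "(h * a j + n - 1) mod n < n" using assms(1) by simp
    then show ?thesis using mult_div_mod_eq[of n "h * a j + n - 1"] by linarith
  qed
  ultimately show ?thesis using assms
    by (auto simp: split_state_def class_state_def connectable_def partition_on_def mult.commute)
qed

lemma split_state_exists:
  assumes "finite V" and "card V = n" and "n \<ge> 1" and "h \<ge> 1" and "(\<Sum>j\<in>{1..k}. a j) = lam * (n choose h)"
  shows "\<exists>x. split_state lam n h k a V x"
proof -
  have "\<exists>x. split_state lam n h k a W x" if "W \<subseteq> V" for W
    using finite_subset[OF that assms(1)] that
  proof (induction W rule: finite_induct)
    case empty
    then show ?case using split_state_empty[OF assms(3-5)] by blast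
  next
    case (insert v W)
    then obtain x where "split_state lam n h k a W x" by auto
    moreover have "card W < n"
      using insert assms(1,2) by (metis insert_subset psubsetI psubset_card_mono)
    ultimately show ?case using split_state_step[OF insert(1,2)] by blast
  qed
  then show ?thesis by blast
qed

section \<open>The complete hypergraph\<close>

text \<open>Grow a vertex set from one vertex by adding incident hyperedges: each contributes at most
  \<open>h - 1\<close> new vertices.\<close>

lemma hconnected_size_bound:
  assumes fin: "finite (verts G)" and conn: "hconnected G"
    and edges: "\<And>e. e \<in># edges G \<Longrightarrow> e \<subseteq> verts G \<and> card e = h"
  shows "card (verts G) - 1 \<le> (h - 1) * size (edges G)"
proof (cases "verts G = {}")
  case False
  then obtain u where u: "u \<in> verts G" by blast
  \<comment> \<open>\<open>good m\<close> says that some \<open>m\<close> edges lie inside a set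
    \<open>R\<close> containing \<open>u\<close> that is no larger than growth by
    \<open>h - 1\<close> per edge allows; a largest such \<open>m\<close> exists because
    \<open>m\<close> is at most the number of edges.\<close>
  define good where "good m \<longleftrightarrow> (\<exists>T R. T \<subseteq># edges G \<and> size T = m \<and> u \<in> R \<and> R \<subseteq> verts G \<and>
     card R \<le> 1 + (h - 1) * m \<and> (\<forall>e\<in>#T. e \<subseteq> R))" for m
  have "good 0" unfolding good_def using u by (intro exI[of _ "{#}"] exI[of _ "{u}"]) auto
  moreover have bounded: "m \<le> size (edges G)" if "good m" for m
    using that size_mset_mono unfolding good_def by blast
  ultimately obtain m where m: "good m" "\<And>m'. good m' \<Longrightarrow> m' \<le> m"
    using GreatestI_nat Greatest_le_nat by metis
  then obtain T R where TR: "T \<subseteq># edges G" "size T = m" "u \<in> R" "R \<subseteq> verts G"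
    "card R \<le> 1 + (h - 1) * m" "\<And>e. e \<in># T \<Longrightarrow> e \<subseteq> R" by (auto simp: good_def)
  have finR: "finite R" using TR(4) fin finite_subset by blast
  have "R = verts G"
  proof (rule ccontr)
    assume "R \<noteq> verts G"
    then obtain w where w: "w \<in> verts G" "w \<notin> R" using TR(4) by blast
    have "(hadjacent G)\<^sup>*\<^sup>* u w" using conn u w by (simp add: hconnected_def)
    then have "w \<in> R" if "\<And>a b. a \<in> R \<Longrightarrow> hadjacent G a b \<Longrightarrow> b \<in> R"
      using TR(3) that by (induction rule: rtranclp_induct) blast+
    then obtain a b where ab: "a \<in> R" "hadjacent G a b" "b \<notin> R" using w by blast
    then obtain e where e: "e \<in># edges G" "a \<in> e" "b \<in> e" by (auto simp: hadjacent_def)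
    \<comment> \<open>Edges of \<open>T\<close> stay inside \<open>R\<close>, but \<open>b\<close>
      does not. So \<open>e\<close> has count 0 in \<open>T\<close>, and adding one copy respects
      the multiplicities of \<open>G\<close>.\<close>
    have "e \<notin># T" using TR(6) e ab by blast
    then have sub: "add_mset e T \<subseteq># edges G"
      using mset_subset_eq_count[OF TR(1)] e(1)
      by (intro mset_subset_eqI) (auto simp: not_in_iff Suc_le_eq)
    have fine: "finite e" using edges[OF e(1)] fin finite_subset by blast
    have "R \<union> e = R \<union> (e - {a})" using ab by auto
    then have "card (R \<union> e) \<le> card R + card (e - {a})" by (metis card_Un_le)
    also have "card (e - {a}) = h - 1" using edges[OF e(1)] e(2) fine by simp
    finally have "card (R \<union> e) \<le> 1 + (h - 1) * Suc m" using TR(5) by simp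
    moreover have "R \<union> e \<subseteq> verts G" using TR(4) edges[OF e(1)] by blast
    ultimately have "good (Suc m)" unfolding good_def using sub TR
      by (intro exI[of _ "add_mset e T"] exI[of _ "R \<union> e"]) auto
    then show False using m(2)[of "Suc m"] by simp
  qed
  then have "card (verts G) \<le> 1 + (h - 1) * m" using TR(5) by simp
  also have "(h - 1) * m \<le> (h - 1) * size (edges G)" using bounded[OF m(1)] by (rule mult_le_mono2)
  finally show ?thesis by simp
qed simp

lemma size_filter_sum_replicate_mset:
  assumes "finite A"
  shows "size (filter_mset Q (\<Sum>S\<in>A. replicate_mset (x S) S)) = (\<Sum>S\<in>A. if Q S then x S else 0)"
  using assms
proof (induction A rule: finite_induct)
  case (insert S A)
  have "filter_mset Q (replicate_mset m S) = (if Q S then replicate_mset m S else {#})" for m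
    by (induction m) auto
  then show ?case using insert by simp
qed simp

lemma count_sum_replicate_mset:
  assumes "finite A"
  shows "count (\<Sum>S\<in>A. replicate_mset (x S) S) S' = (if S' \<in> A then x S' else 0)"
  using assms by (simp add: count_sum)

theorem theorem5p1:
  fixes lam n h k :: nat and a :: "nat \<Rightarrow> nat" and V :: "'a set"
  assumes "lam \<ge> 1" and "n \<ge> 1" and "h \<ge> 1"
    and "finite V" and "card V = n"
    and "\<And>j. j \<in> {1..k} \<Longrightarrow> a j \<ge> 1"
    and "(\<Sum>j\<in>{1..k}. a j) = lam * (n choose h)"
  shows "\<exists>F :: nat \<Rightarrow> 'a hypergraph.
           spanning_decomposition (complete_hypergraph lam V h) {1..k} F \<and>
           (\<forall>j\<in>{1..k}.
              almost_regular (F j) \<and>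
              size (edges (F j)) = a j \<and>
              (\<forall>v\<in>V. approx (real (hdegree (F j) v)) (real h * real (a j) / real n)) \<and>
              (hconnected (F j) \<longleftrightarrow> (h - 1) * a j \<ge> n - 1))"
proof -
  obtain x where x: "split_state lam n h k a V x"
    using split_state_exists[OF assms(4,5,2,3,7)] by blast
  \<comment> \<open>No vertex remains amalgamated, and \<open>0 choose (h - card S)\<close> vanishes
    unless \<open>card S = h\<close>.\<close>
  have total: "(\<Sum>j\<in>{1..k}. x j S) = (if card S = h then lam else 0)" if "S \<subseteq> V" "card S \<le> h" for S
    using x that assms(5) by (auto simp: split_state_def)
  have cls: "class_state n h (a j) V (x j)" if "j \<in> {1..k}" for j
    using x that by (simp add: split_state_def)
  have supp: "S \<subseteq> V \<and> card S \<le> h" if "x j S > 0" "j \<in> {1..k}" for j S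
    using cls[OF that(2)] that(1) by (simp add: class_state_def)
  have finPow: "finite (Pow V)" using assms(4) by simp
  define F where "F j = \<lparr>verts = V, edges = (\<Sum>S\<in>Pow V. replicate_mset (x j S) S)\<rparr>" for j
  have vertsF: "verts (F j) = V" for j by (simp add: F_def)
  have countF: "count (edges (F j)) S = x j S" if "j \<in> {1..k}" for j S
    using supp[of j S] that count_sum_replicate_mset[OF finPow, of "x j" S] by (auto simp: F_def)
  have total': "(\<Sum>j\<in>{1..k}. x j S) = lam * (if S \<subseteq> V \<and> card S = h then 1 else 0)" for S
  proof (cases "S \<subseteq> V \<and> card S \<le> h")
    case True
    then show ?thesis using total[of S] by simp
  next
    case False
    then have "x j S = 0" if "j \<in> {1..k}" for j using supp[of j S] that by auto
    then show ?thesis using False by auto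
  qed
  have count_complete: "count (edges (complete_hypergraph lam V h)) S = (\<Sum>j\<in>{1..k}. x j S)" for S
    unfolding total' using assms(4) by (simp add: complete_hypergraph_def count_mset_set')
  have edgeF: "e \<subseteq> V \<and> card e = h" if "e \<in># edges (F j)" "j \<in> {1..k}" for e j
  proof -
    have "x j e > 0" using countF[OF that(2), of e] that(1) by (simp flip: count_greater_zero_iff)
    then have "(\<Sum>j\<in>{1..k}. x j e) \<noteq> 0" using that(2) by auto
    then show ?thesis unfolding total' by (auto split: if_splits)
  qed
  have "spanning_decomposition (complete_hypergraph lam V h) {1..k} F"
    unfolding spanning_decomposition_def spanning_subhypergraph_def
  proof (intro conjI ballI)
    fix j assume j: "j \<in> {1..k}"
    show "verts (F j) = verts (complete_hypergraph lam V h)" by (simp add: F_def complete_hypergraph_def)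
    show "edges (F j) \<subseteq># edges (complete_hypergraph lam V h)"
    proof (rule mset_subset_eqI)
      show "count (edges (F j)) S \<le> count (edges (complete_hypergraph lam V h)) S" for S
        unfolding countF[OF j] count_complete using j by (intro member_le_sum) auto
    qed
  next
    show "(\<Sum>j\<in>{1..k}. edges (F j)) = edges (complete_hypergraph lam V h)"
    proof (rule multiset_eqI)
      show "count (\<Sum>j\<in>{1..k}. edges (F j)) S = count (edges (complete_hypergraph lam V h)) S" for S
        unfolding count_complete count_sum by (intro sum.cong) (auto simp: countF)
    qed
  qed
  moreover have "almost_regular (F j) \<and> size (edges (F j)) = a j \<and>
      (\<forall>v\<in>V. approx (real (hdegree (F j) v)) (real h * real (a j) / real n)) \<and>
      (hconnected (F j) \<longleftrightarrow> (h - 1) * a j \<ge> n - 1)" if j: "j \<in> {1..k}" for j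
  proof -
    have deg: "fair n (h * a j) (hdegree (F j) v)" if "v \<in> V" for v
      using cls[OF j] that size_filter_sum_replicate_mset[OF finPow, of "\<lambda>e. v \<in> e" "x j"]
      by (simp add: class_state_def hdegree_def F_def)
    have size: "size (edges (F j)) = a j"
      using cls[OF j] size_filter_sum_replicate_mset[OF finPow, of "\<lambda>_. True" "x j"]
      by (simp add: class_state_def F_def)
    \<comment> \<open>The ceiling exceeds the floor by at most one, so the floor serves as the
      integer \<open>d\<close> of almost regularity.\<close>
    have "(h * a j + n - 1) div n \<le> (h * a j + n) div n" by (intro div_le_mono) simp
    also have "\<dots> = h * a j div n + 1" using assms(2) by simp
    finally have "hdegree (F j) v = h * a j div n \<or> hdegree (F j) v = h * a j div n + 1" if "v \<in> V" for v
      using deg[OF that] unfolding fair_def by linarith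
    then have regular: "almost_regular (F j)"
      unfolding almost_regular_def vertsF by (intro exI[of _ "int (h * a j div n)"]) force
    have "approx (real (hdegree (F j) v)) (real h * real (a j) / real n)" if "v \<in> V" for v
      using fair_approx[OF assms(2) deg[OF that]] by simp
    moreover have "hconnected (F j)" if big: "(h - 1) * a j \<ge> n - 1"
    proof -
      have adj: "hadjacent (F j) = shares (x j)"
        unfolding hadjacent_def shares_def countF[OF j, symmetric] by (simp add: fun_eq_iff)
      \<comment> \<open>At \<open>f = 0\<close> connectability leaves at most one block, and that
        block covers \<open>V\<close>.\<close>
      obtain P where P: "connectable h 0 V (x j) P"
        using cls[OF j] big assms(5) by (auto simp: class_state_def)
      then have UP: "\<Union>P = V" and card: "card P \<le> 1" and linked: "\<And>C u w. C \<in> P \<Longrightarrow> u \<in> C \<Longrightarrow> w \<in> C \<Longrightarrow> (shares (x j))\<^sup>*\<^sup>* u w"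
        by (auto simp: connectable_def partition_on_def)
      have finP: "finite P" using UP assms(4) finite_UnionD by metis
      have "(shares (x j))\<^sup>*\<^sup>* u w" if uw: "u \<in> V" "w \<in> V" for u w
      proof -
        obtain C C' where C: "C \<in> P" "u \<in> C" "C' \<in> P" "w \<in> C'" using uw UP by blast
        then have "C = C'" using card card_le_Suc0_iff_eq[OF finP] by auto
        then show ?thesis using C linked by blast
      qed
      then show ?thesis unfolding hconnected_def adj vertsF by blast
    qed
    moreover have "(h - 1) * a j \<ge> n - 1" if "hconnected (F j)"
      using hconnected_size_bound[of "F j" h] that edgeF j assms(4,5) size by (simp add: vertsF)
    ultimately show ?thesis using regular size by blast
  qed
  ultimately show ?thesis by blast
qed

end
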